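(* Let $\underline C=(C_1,\dots,C_d)$ be a coisometric tuple on a Hilbert space $\mathcal H_C$, let $\underline E=(E_1,\dots,E_d)$ be a coisometric lifting of $\underline C$ on a Hilbert space $\mathcal H_E\supset\mathcal H_C$, let $\underline{\widehat V}^C=(\widehat V_1^C,\dots,\widehat V_d^C)$ on $\widehat{\mathcal H}_C$ and $\underline{\widehat V}^E=(\widehat V_1^E,\dots,\widehat V_d^E)$ on $\widehat{\mathcal H}_E$ be the minimal isometric dilations of $\underline C$ and $\underline E$ in Popescu's presentation, and let $\widehat W:\widehat{\mathcal H}_E\to\widehat{\mathcal H}_C$ be the coisometry defined in the context. Then for $j=1,\dots,d$, $$\widehat W\,\widehat V_j^E=\widehat V_j^C\,\widehat W\qquad\text{and}\qquad \widehat V_j^E\,\widehat W^*=\widehat W^*\,\widehat V_j^C .$$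
   Context: Let $d\ge 1$ be finite. For a tuple $\underline T=(T_1,\dots,T_d)$ of bounded operators on a Hilbert space $\mathcal L$: $\underline T$ is a row contraction if $\sum_j T_jT_j^*\le I$, and coisometric if $\sum_jT_jT_j^*=I$. For a row contraction, regarded as a row operator $\underline T:\bigoplus_1^d\mathcal L\to\mathcal L$, put $D_T=(I-\underline T^*\underline T)^{1/2}:\bigoplus_1^d\mathcal L\to\bigoplus_1^d\mathcal L$, let $\mathcal D_T$ be the closure of the range of $D_T$, and let $(D_T)_j:\mathcal L\to\mathcal D_T$ be $(D_T)_j\ell=D_T(0,\dots,\ell,\dots,0)$ with $\ell$ in the $j$-th component; $(D_T)_j^*:\mathcal D_T\to\mathcal L$ is its adjoint. $\tilde\Lambda$ is the free semigroup (with empty word $\emptyset$) on $1,\dots,d$; $|\alpha|$ is the length of a word $\alpha$. $\Gamma=\bigoplus_{m\ge0}(\mathbb C^d)^{\otimes m}$ is the full Fock space with orthonormal basis $e_\alpha=e_{\alpha_1}\otimes\cdots\otimes e_{\alpha_m}$, $\alpha=\alpha_1\cdots\alpha_m\in\tilde\Lambda$, where $\{e_1,\dots,e_d\}$ is the standard basis of $\mathbb C^d$ and $e_\emptyset$ is the vacuum vector. Popescu's presentation of the minimal isometric dilation of a row contraction $\underline T$ is the tuple $\underline V=(V_1,\dots,V_d)$ on $\mathcal L\oplus(\Gamma\otimes\mathcal D_T)$ given by $$V_j\Big(\ell\oplus\sum_{\alpha\in\tilde\Lambda}e_\alpha\otimes d_\alpha\Big)=T_j\ell\oplus\Big[e_\emptyset\otimes(D_T)_j\ell+e_j\otimes\sum_{\alpha\in\tilde\Lambda}e_\alpha\otimes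 d_\alpha\Big].$$ Applied to $\underline C$ and $\underline E$ this gives $\underline{\widehat V}^C$ on $\widehat{\mathcal H}_C=\mathcal H_C\oplus(\Gamma\otimes\mathcal D_C)$ and $\underline{\widehat V}^E$ on $\widehat{\mathcal H}_E=\mathcal H_E\oplus(\Gamma\otimes\mathcal D_E)$. A coisometric tuple $\underline E$ on $\mathcal H_E\supset\mathcal H_C$ is a coisometric lifting of $\underline C$ if, with respect to $\mathcal H_E=\mathcal H_C\oplus\mathcal H_C^\perp$, $E_j=\begin{pmatrix}C_j&0\\ B_j&A_j\end{pmatrix}$ for $j=1,\dots,d$. Let $\mathcal P$ be a $d$-dimensional Hilbert space with orthonormal basis $\epsilon_1,\dots,\epsilon_d$, and $\mathcal P_{[1,n]}=\mathcal P^{\otimes n}$ (for $n=0$: $\mathcal P_{[1,0]}=\mathbb C$). For $n\ge1$ the unitary $$\tilde U_n:\mathcal H_C\otimes\mathcal P_{[1,n-1]}\oplus\bigoplus_{m\ge n-1}\big((\mathbb C^d)^{\otimes m}\otimes\mathcal D_C\big)\to\mathcal H_C\otimes\mathcal P_{[1,n]}\oplus\bigoplus_{m\ge n}\big((\mathbb C^d)^{\otimes m}\otimes\mathcal D_C\big)$$ is defined by $$\tilde U_n\Big(\sum_{j_1,\dots,j_{n-1}}\tilde h_{j_1\cdots j_{n-1}}\otimes\epsilon_{j_1}\otimes\cdots\otimes\epsilon_{j_{n-1}}\oplus\sum_{j_1,\dots,j_{n-1}}e_{j_1}\otimes\cdots\otimes e_{j_{n-1}}\otimes y_{j_1\cdots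 j_{n-1}}\oplus\sum_{|\alpha|\ge n}e_\alpha\otimes y_\alpha\Big)$$ $$=\sum_{j_1,\dots,j_n}\big(C_{j_n}^*\tilde h_{j_1\cdots j_{n-1}}+(D_C)_{j_n}^*y_{j_1\cdots j_{n-1}}\big)\otimes\epsilon_{j_1}\otimes\cdots\otimes\epsilon_{j_n}\oplus\sum_{|\alpha|\ge n}e_\alpha\otimes y_\alpha ,$$ with $\tilde h_{\cdots}\in\mathcal H_C$, $y_{\cdots}\in\mathcal D_C$, all indices running over $1,\dots,d$ (for $n=1$: $\tilde U_1(\tilde h\oplus\sum_\alpha e_\alpha\otimes y_\alpha)=\sum_j(C_j^*\tilde h+(D_C)_j^*y_\emptyset)\otimes\epsilon_j\oplus\sum_{|\alpha|\ge1}e_\alpha\otimes y_\alpha$ on $\widehat{\mathcal H}_C$). The unitaries $U_n$ ($n\ge1$) are defined by the same formulas with $\mathcal H_C,\mathcal D_C,C_j,(D_C)_j$ replaced by $\mathcal H_E,\mathcal D_E,E_j,(D_E)_j$. $Q_n$ is the orthogonal projection of $\widehat{\mathcal H}_C$ onto $\mathcal H_C\oplus\bigoplus_{m\le n-1}((\mathbb C^d)^{\otimes m}\otimes\mathcal D_C)$, and $P_n$ is the orthogonal projection of $\mathcal H_E\otimes\mathcal P_{[1,n]}\oplus\bigoplus_{m\ge n}((\mathbb C^d)^{\otimes m}\otimes\mathcal D_E)$ onto $\mathcal H_C\otimes\mathcal P_{[1,n]}$, the latter being regarded as a subspace both of the codomain of $\tilde U_n$ and of the codomain of $U_n$. The coisometry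 $\widehat W$ is $$\widehat W=\text{sot-}\lim_{n\to\infty}\tilde U_1^*\cdots\tilde U_n^*P_nU_n\cdots U_1,\qquad \widehat W^*=\text{sot-}\lim_{n\to\infty}U_1^*\cdots U_n^*\tilde U_n\cdots\tilde U_1Q_n ,$$ where sot denotes the strong operator topology (both limits exist). *)

theory Defs
  imports "HOL-Analysis.Analysis"
begin

section \<open>Complex Hilbert spaces\<close>

text \<open>The inner product is conjugate-linear in its first argument.\<close>

class complex_inner = real_normed_vector +
  fixes scaleC :: "complex \<Rightarrow> 'a \<Rightarrow> 'a" (infixr \<open>*\<^sub>C\<close> 75)
    and cinner :: "'a \<Rightarrow> 'a \<Rightarrow> complex"
  assumes scaleC_add_right: "a *\<^sub>C (x + y) = a *\<^sub>C x + a *\<^sub>C y"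
    and scaleC_add_left: "(a + b) *\<^sub>C x = a *\<^sub>C x + b *\<^sub>C x"
    and scaleC_scaleC: "a *\<^sub>C b *\<^sub>C x = (a * b) *\<^sub>C x"
    and scaleC_one: "1 *\<^sub>C x = x"
    and scaleR_scaleC: "scaleR r x = complex_of_real r *\<^sub>C x"
    and cinner_commute: "cinner x y = cnj (cinner y x)"
    and cinner_add_right: "cinner x (y + z) = cinner x y + cinner x z"
    and cinner_scaleC_right: "cinner x (a *\<^sub>C y) = a * cinner x y"
    and cinner_self: "cinner x x = complex_of_real ((norm x)\<^sup>2)"

class chilbert_space = complex_inner + banach

lemma norm_scaleC: "norm (a *\<^sub>C x) = cmod a * norm (x :: 'a :: complex_inner)"
proof -
  have "cinner (a *\<^sub>C x) (a *\<^sub>C x) = a * (cnj a * cinner x x)"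
    by (metis cinner_commute cinner_scaleC_right complex_cnj_mult)
  then have "complex_of_real ((norm (a *\<^sub>C x))\<^sup>2) = complex_of_real ((cmod a * norm x)\<^sup>2)"
    unfolding cinner_self
    by (metis ab_semigroup_mult_class.mult_ac(1) complex_norm_square of_real_mult power_mult_distrib)
  then have "(norm (a *\<^sub>C x))\<^sup>2 = (cmod a * norm x)\<^sup>2"
    by (simp only: of_real_eq_iff)
  then show ?thesis
    by (simp add: power2_eq_iff_nonneg)
qed

lemma Re_cinner_le: "Re (cinner x y) \<le> norm x * norm (y :: 'a :: complex_inner)"
proof -
  have "cinner (x + y) (x + y) = cinner x x + cinner y y + (cinner x y + cnj (cinner x y))"
    by (metis (no_types, opaque_lifting) add.assoc add.commute cinner_add_right cinner_commute
        complex_cnj_add)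
  then have "Re (cinner (x + y) (x + y)) = Re (cinner x x) + Re (cinner y y) + 2 * Re (cinner x y)"
    by simp
  then have "(norm (x + y))\<^sup>2 = (norm x)\<^sup>2 + (norm y)\<^sup>2 + 2 * Re (cinner x y)"
    unfolding cinner_self Re_complex_of_real .
  moreover have "(norm (x + y))\<^sup>2 \<le> (norm x + norm y)\<^sup>2"
    by (simp add: norm_triangle_ineq power_mono)
  ultimately show ?thesis
    by (simp add: power2_sum)
qed

lemma norm_cinner_le: "cmod (cinner x y) \<le> norm x * norm (y :: 'a :: complex_inner)"
proof (cases "cinner x y = 0")
  case False
  define u where "u = cnj (cinner x y) / cmod (cinner x y)"
  have u: "cmod u = 1"
    using False by (simp add: u_def norm_divide)
  have "cinner x y * cnj (cinner x y) = (complex_of_real (cmod (cinner x y)))\<^sup>2"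
    using complex_norm_square[of "cinner x y"] by simp
  then have "u * cinner x y = complex_of_real (cmod (cinner x y))"
    using False by (simp add: u_def power2_eq_square mult.commute)
  then have "cmod (cinner x y) = Re (cinner x (u *\<^sub>C y))"
    by (simp add: cinner_scaleC_right)
  also have "\<dots> \<le> norm x * norm (u *\<^sub>C y)"
    by (rule Re_cinner_le)
  finally show ?thesis
    by (simp add: norm_scaleC u)
qed simp

instantiation prod :: (complex_inner, complex_inner) complex_inner
begin

definition scaleC_prod :: "complex \<Rightarrow> 'a \<times> 'b \<Rightarrow> 'a \<times> 'b"
  where "scaleC_prod a x = (a *\<^sub>C fst x, a *\<^sub>C snd x)"

definition cinner_prod :: "'a \<times> 'b \<Rightarrow> 'a \<times> 'b \<Rightarrow> complex"
  where "cinner_prod x y = cinner (fst x) (fst y) + cinner (snd x) (snd y)"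

instance
proof
  fix x y :: "'a \<times> 'b"
  show "cinner x y = cnj (cinner y x)"
    by (simp add: cinner_prod_def cinner_commute[symmetric])
qed (simp_all add: scaleC_prod_def cinner_prod_def prod_eq_iff scaleC_add_right scaleC_add_left
      scaleC_scaleC scaleC_one scaleR_scaleC cinner_add_right cinner_scaleC_right cinner_self
      norm_prod_def algebra_simps)

end

instance prod :: (chilbert_space, chilbert_space) chilbert_space ..

instantiation vec :: (complex_inner, finite) complex_inner
begin

definition scaleC_vec :: "complex \<Rightarrow> 'a ^ 'b \<Rightarrow> 'a ^ 'b"
  where "scaleC_vec a x = (\<chi> i. a *\<^sub>C x $ i)"

definition cinner_vec :: "'a ^ 'b \<Rightarrow> 'a ^ 'b \<Rightarrow> complex"
  where "cinner_vec x y = (\<Sum>i\<in>UNIV. cinner (x $ i) (y $ i))"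

instance
proof
  fix x y :: "'a ^ 'b"
  show "cinner x y = cnj (cinner y x)"
    by (simp add: cinner_vec_def cinner_commute[symmetric])
  show "cinner x x = complex_of_real ((norm x)\<^sup>2)"
    by (simp add: cinner_vec_def norm_vec_def L2_set_def sum_nonneg cinner_self)
qed (simp_all add: scaleC_vec_def cinner_vec_def vec_eq_iff scaleC_add_right scaleC_add_left
      scaleC_scaleC scaleC_one scaleR_scaleC cinner_add_right cinner_scaleC_right
      sum.distrib sum_distrib_left)

end

instance vec :: (chilbert_space, finite) chilbert_space ..


section \<open>Square-summable families\<close>

text \<open>\<open>('i, 'a) l2\<close> is the Hilbert space tensor product of \<open>\<ell>\<^sup>2('i)\<close> with \<open>'a\<close>:
  the family \<open>x\<close> stands for \<open>\<Sum>i. e\<^sub>i \<otimes> x i\<close>.\<close>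

typedef (overloaded) ('i, 'a :: real_normed_vector) l2 =
  "{x :: 'i \<Rightarrow> 'a. (\<lambda>i. (norm (x i))\<^sup>2) summable_on UNIV}"
  morphisms l2_coord Abs_l2
  by (rule exI[of _ "\<lambda>_. 0"]) simp

lemma l2_summable: "(\<lambda>i. (norm (l2_coord x i))\<^sup>2) summable_on UNIV"
  using l2_coord[of x] by simp

lemma l2_coord_Abs_l2:
  "(\<lambda>i. (norm (x i))\<^sup>2) summable_on UNIV \<Longrightarrow> l2_coord (Abs_l2 x) = x"
  by (simp add: Abs_l2_inverse)

lemma l2_eq_iff: "x = y \<longleftrightarrow> (\<forall>i. l2_coord x i = l2_coord y i)"
  by (metis ext l2_coord_inject)

lemma l2_summable_add:
  assumes "(\<lambda>i. (norm (x i :: 'a :: real_normed_vector))\<^sup>2) summable_on UNIV"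
    and "(\<lambda>i. (norm (y i))\<^sup>2) summable_on UNIV"
  shows "(\<lambda>i. (norm (x i + y i))\<^sup>2) summable_on UNIV"
proof (rule summable_on_comparison_test)
  show "(\<lambda>i. 2 * ((norm (x i))\<^sup>2 + (norm (y i))\<^sup>2)) summable_on UNIV"
    by (intro summable_on_cmult_right summable_on_add assms)
  fix i
  have "(norm (x i + y i))\<^sup>2 \<le> (norm (x i) + norm (y i))\<^sup>2"
    by (simp add: norm_triangle_ineq power_mono)
  also have "\<dots> \<le> 2 * ((norm (x i))\<^sup>2 + (norm (y i))\<^sup>2)"
    using sum_squares_bound[of "norm (x i)" "norm (y i)"] by (simp add: power2_sum)
  finally show "(norm (x i + y i))\<^sup>2 \<le> 2 * ((norm (x i))\<^sup>2 + (norm (y i))\<^sup>2)" .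
qed auto

instantiation l2 :: (type, real_normed_vector) real_vector
begin

definition zero_l2 :: "('a, 'b) l2" where "zero_l2 = Abs_l2 (\<lambda>_. 0)"
definition plus_l2 :: "('a, 'b) l2 \<Rightarrow> ('a, 'b) l2 \<Rightarrow> ('a, 'b) l2"
  where "plus_l2 x y = Abs_l2 (\<lambda>i. l2_coord x i + l2_coord y i)"
definition uminus_l2 :: "('a, 'b) l2 \<Rightarrow> ('a, 'b) l2"
  where "uminus_l2 x = Abs_l2 (\<lambda>i. - l2_coord x i)"
definition minus_l2 :: "('a, 'b) l2 \<Rightarrow> ('a, 'b) l2 \<Rightarrow> ('a, 'b) l2"
  where "minus_l2 x y = Abs_l2 (\<lambda>i. l2_coord x i - l2_coord y i)"
definition scaleR_l2 :: "real \<Rightarrow> ('a, 'b) l2 \<Rightarrow> ('a, 'b) l2"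
  where "scaleR_l2 r x = Abs_l2 (\<lambda>i. r *\<^sub>R l2_coord x i)"

lemma l2_coord_zero [simp]: "l2_coord 0 i = 0"
  by (simp add: zero_l2_def l2_coord_Abs_l2)

lemma l2_coord_add [simp]: "l2_coord (x + y) i = l2_coord x i + l2_coord y i"
  by (simp add: plus_l2_def l2_coord_Abs_l2 l2_summable_add l2_summable)

lemma l2_coord_uminus [simp]: "l2_coord (- x) i = - l2_coord x i"
  by (simp add: uminus_l2_def l2_coord_Abs_l2 l2_summable)

lemma l2_coord_diff [simp]: "l2_coord (x - y) i = l2_coord x i - l2_coord y i"
  using l2_summable_add[OF l2_summable[of x] l2_summable[of "- y"]]
  by (simp add: minus_l2_def l2_coord_Abs_l2)

lemma l2_coord_scaleR [simp]: "l2_coord (r *\<^sub>R x) i = r *\<^sub>R l2_coord x i"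
  by (simp add: scaleR_l2_def l2_coord_Abs_l2 power_mult_distrib summable_on_cmult_right l2_summable)

instance
  by standard (simp_all add: l2_eq_iff scaleR_add_right scaleR_add_left)

end

instantiation l2 :: (type, real_normed_vector) real_normed_vector
begin

definition norm_l2 :: "('a, 'b) l2 \<Rightarrow> real"
  where "norm_l2 x = sqrt (\<Sum>\<^sub>\<infinity>i. (norm (l2_coord x i))\<^sup>2)"
definition dist_l2 :: "('a, 'b) l2 \<Rightarrow> ('a, 'b) l2 \<Rightarrow> real"
  where "dist_l2 x y = norm (x - y)"
definition sgn_l2 :: "('a, 'b) l2 \<Rightarrow> ('a, 'b) l2"
  where "sgn_l2 x = x /\<^sub>R norm x"
definition uniformity_l2 :: "(('a, 'b) l2 \<times> ('a, 'b) l2) filter"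
  where "uniformity_l2 = (INF e\<in>{0<..}. principal {(x, y). dist x y < e})"
definition open_l2 :: "('a, 'b) l2 set \<Rightarrow> bool"
  where "open_l2 S \<longleftrightarrow> (\<forall>x\<in>S. \<forall>\<^sub>F (x', y) in uniformity. x' = x \<longrightarrow> y \<in> S)"

lemma norm_l2_ge: "finite F \<Longrightarrow> L2_set (\<lambda>i. norm (l2_coord x i)) F \<le> norm x"
  unfolding norm_l2_def L2_set_def
  by (intro real_sqrt_le_mono finite_sum_le_infsum l2_summable) auto

lemma norm_l2_le:
  assumes "\<And>F. finite F \<Longrightarrow> L2_set (\<lambda>i. norm (l2_coord x i)) F \<le> K"
  shows "norm x \<le> K"
proof -
  have K: "0 \<le> K" using assms[of "{}"] by simp
  have "(\<Sum>\<^sub>\<infinity>i. (norm (l2_coord x i))\<^sup>2) \<le> K\<^sup>2"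
  proof (rule infsum_le_finite_sums[OF l2_summable])
    fix F :: "'a set" assume "finite F"
    from assms[OF this] show "(\<Sum>i\<in>F. (norm (l2_coord x i))\<^sup>2) \<le> K\<^sup>2"
      by (simp add: L2_set_def sqrt_le_D)
  qed
  then show ?thesis
    unfolding norm_l2_def using K by (rule real_le_lsqrt[rotated -1])
qed

instance
proof
  fix x y :: "('a, 'b) l2" and r :: real
  show "norm x = 0 \<longleftrightarrow> x = 0"
  proof
    assume "norm x = 0"
    then have "norm (l2_coord x i) = 0" for i
      using norm_l2_ge[of "{i}" x] by (simp add: L2_set_def)
    then show "x = 0" by (simp add: l2_eq_iff)
  qed (simp add: norm_l2_def)
  show "norm (x + y) \<le> norm x + norm y"
  proof (rule norm_l2_le)
    fix F :: "'a set" assume F: "finite F"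
    have "L2_set (\<lambda>i. norm (l2_coord (x + y) i)) F
        \<le> L2_set (\<lambda>i. norm (l2_coord x i) + norm (l2_coord y i)) F"
      by (rule L2_set_mono) (simp_all add: norm_triangle_ineq)
    also have "\<dots> \<le> L2_set (\<lambda>i. norm (l2_coord x i)) F + L2_set (\<lambda>i. norm (l2_coord y i)) F"
      by (rule L2_set_triangle_ineq)
    also have "\<dots> \<le> norm x + norm y"
      by (intro add_mono norm_l2_ge F)
    finally show "L2_set (\<lambda>i. norm (l2_coord (x + y) i)) F \<le> norm x + norm y" .
  qed
  show "norm (r *\<^sub>R x) = \<bar>r\<bar> * norm x"
    by (simp add: norm_l2_def power_mult_distrib infsum_cmult_right' real_sqrt_mult)
qed (simp_all add: dist_l2_def sgn_l2_def uniformity_l2_def open_l2_def)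

end

lemma l2_coord_norm_le: "norm (l2_coord x i) \<le> norm x"
  using norm_l2_ge[of "{i}" x] by (simp add: L2_set_def)

instance l2 :: (type, banach) banach
proof
  fix X :: "nat \<Rightarrow> ('a, 'b) l2"
  assume X: "Cauchy X"
  have "Cauchy (\<lambda>n. l2_coord (X n) i)" for i
  proof (rule CauchyI)
    fix e :: real assume "0 < e"
    then obtain M where "\<forall>m\<ge>M. \<forall>n\<ge>M. norm (X m - X n) < e"
      using CauchyD[OF X] by blast
    then show "\<exists>M. \<forall>m\<ge>M. \<forall>n\<ge>M. norm (l2_coord (X m) i - l2_coord (X n) i) < e"
      by (metis l2_coord_diff l2_coord_norm_le order_le_less_trans)
  qed
  then obtain f where f: "\<And>i. (\<lambda>n. l2_coord (X n) i) \<longlonglongrightarrow> f i"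
    unfolding Cauchy_convergent_iff convergent_def by metis
  have tail: "\<exists>M. \<forall>n\<ge>M. \<forall>F. finite F \<longrightarrow> L2_set (\<lambda>i. norm (l2_coord (X n) i - f i)) F \<le> e"
    if e: "0 < e" for e :: real
  proof -
    obtain M where M: "\<forall>m\<ge>M. \<forall>n\<ge>M. norm (X m - X n) < e"
      using CauchyD[OF X e] by blast
    have "L2_set (\<lambda>i. norm (l2_coord (X n) i - f i)) F \<le> e" if n: "n \<ge> M" and F: "finite F" for n F
    proof (rule tendsto_upperbound)
      show "(\<lambda>m. L2_set (\<lambda>i. norm (l2_coord (X n) i - l2_coord (X m) i)) F)
          \<longlonglongrightarrow> L2_set (\<lambda>i. norm (l2_coord (X n) i - f i)) F"
        unfolding L2_set_def by (intro tendsto_intros f)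
      show "\<forall>\<^sub>F m in sequentially. L2_set (\<lambda>i. norm (l2_coord (X n) i - l2_coord (X m) i)) F \<le> e"
        unfolding eventually_sequentially
      proof (intro exI allI impI)
        fix m assume "M \<le> m"
        then have "norm (X n - X m) < e" using M n by blast
        moreover have "L2_set (\<lambda>i. norm (l2_coord (X n) i - l2_coord (X m) i)) F \<le> norm (X n - X m)"
          using norm_l2_ge[OF F, of "X n - X m"] by simp
        ultimately show "L2_set (\<lambda>i. norm (l2_coord (X n) i - l2_coord (X m) i)) F \<le> e" by simp
      qed
    qed simp
    then show ?thesis by blast
  qed
  obtain M where M: "\<forall>F. finite F \<longrightarrow> L2_set (\<lambda>i. norm (l2_coord (X M) i - f i)) F \<le> 1"
    using tail[of 1] by auto
  have "(\<lambda>i. (norm (l2_coord (X M) i - f i))\<^sup>2) summable_on UNIV"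
  proof (rule nonneg_bdd_above_summable_on)
    show "bdd_above (sum (\<lambda>i. (norm (l2_coord (X M) i - f i))\<^sup>2) ` {F. F \<subseteq> UNIV \<and> finite F})"
      using M by (intro bdd_aboveI2[where M = 1]) (auto simp: L2_set_def)
  qed auto
  then have "(\<lambda>i. (norm (l2_coord (X M) i + - (l2_coord (X M) i - f i)))\<^sup>2) summable_on UNIV"
    by (intro l2_summable_add l2_summable) (simp only: norm_minus_cancel)
  then have Lf: "l2_coord (Abs_l2 f) = f"
    by (simp add: l2_coord_Abs_l2)
  have "X \<longlonglongrightarrow> Abs_l2 f"
  proof (rule LIMSEQ_I)
    fix r :: real assume "0 < r"
    then obtain M where
      M: "\<forall>n\<ge>M. \<forall>F. finite F \<longrightarrow> L2_set (\<lambda>i. norm (l2_coord (X n) i - f i)) F \<le> r / 2"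
      using tail[of "r / 2"] by auto
    have "norm (X n - Abs_l2 f) < r" if "n \<ge> M" for n
    proof -
      have "norm (X n - Abs_l2 f) \<le> r / 2"
        using M that by (intro norm_l2_le) (simp add: Lf)
      with \<open>0 < r\<close> show ?thesis by simp
    qed
    then show "\<exists>M. \<forall>n\<ge>M. norm (X n - Abs_l2 f) < r" by blast
  qed
  then show "convergent X" by (auto simp: convergent_def)
qed

lemma l2_cinner_summable:
  "(\<lambda>i. cinner (l2_coord x i) (l2_coord y i :: 'a :: complex_inner)) summable_on UNIV"
proof (rule abs_summable_summable, rule Infinite_Sum.abs_summable_on_comparison_test')
  show "(\<lambda>i. (norm (l2_coord x i))\<^sup>2 + (norm (l2_coord y i))\<^sup>2) summable_on UNIV"
    by (intro summable_on_add l2_summable)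
  fix i
  have "norm (l2_coord x i) * norm (l2_coord y i) \<le> (norm (l2_coord x i))\<^sup>2 + (norm (l2_coord y i))\<^sup>2"
    using sum_squares_bound[of "norm (l2_coord x i)" "norm (l2_coord y i)"]
      mult_nonneg_nonneg[OF norm_ge_zero[of "l2_coord x i"] norm_ge_zero[of "l2_coord y i"]]
    by linarith
  then show "norm (cinner (l2_coord x i) (l2_coord y i))
      \<le> (norm (l2_coord x i))\<^sup>2 + (norm (l2_coord y i))\<^sup>2"
    using norm_cinner_le order_trans by blast
qed

instantiation l2 :: (type, complex_inner) complex_inner
begin

definition scaleC_l2 :: "complex \<Rightarrow> ('a, 'b) l2 \<Rightarrow> ('a, 'b) l2"
  where "scaleC_l2 a x = Abs_l2 (\<lambda>i. a *\<^sub>C l2_coord x i)"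

definition cinner_l2 :: "('a, 'b) l2 \<Rightarrow> ('a, 'b) l2 \<Rightarrow> complex"
  where "cinner_l2 x y = (\<Sum>\<^sub>\<infinity>i. cinner (l2_coord x i) (l2_coord y i))"

lemma l2_coord_scaleC [simp]: "l2_coord (a *\<^sub>C x) i = a *\<^sub>C l2_coord x i"
  by (simp add: scaleC_l2_def l2_coord_Abs_l2 norm_scaleC power_mult_distrib
      summable_on_cmult_right l2_summable)

instance
proof
  fix x y z :: "('a, 'b) l2" and a :: complex
  show "cinner x y = cnj (cinner y x)"
    by (simp add: cinner_l2_def cinner_commute[symmetric] flip: infsum_cnj)
  show "cinner x (y + z) = cinner x y + cinner x z"
    by (simp add: cinner_l2_def cinner_add_right infsum_add l2_cinner_summable)
  show "cinner x (a *\<^sub>C y) = a * cinner x y"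
    by (simp add: cinner_l2_def cinner_scaleC_right infsum_cmult_right')
  have "((\<lambda>i. complex_of_real ((norm (l2_coord x i))\<^sup>2)) has_sum
      complex_of_real (\<Sum>\<^sub>\<infinity>i. (norm (l2_coord x i))\<^sup>2)) UNIV"
    by (intro has_sum_of_real has_sum_infsum l2_summable)
  then show "cinner x x = complex_of_real ((norm x)\<^sup>2)"
    by (simp add: cinner_l2_def norm_l2_def cinner_self infsum_nonneg infsumI)
qed (simp_all add: l2_eq_iff scaleC_add_right scaleC_add_left scaleC_scaleC scaleC_one scaleR_scaleC)

end

instance l2 :: (type, chilbert_space) chilbert_space ..


section \<open>Operators between closed subspaces\<close>

text \<open>A Hilbert space is represented as a closed complex subspace of a type of class
  \<open>chilbert_space\<close>, and an operator by a function of which only the values on its domain matter.\<close>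

definition closed_csubspace :: "'a::complex_inner set \<Rightarrow> bool"
  where "closed_csubspace S \<longleftrightarrow>
    0 \<in> S \<and> (\<forall>x\<in>S. \<forall>y\<in>S. x + y \<in> S) \<and> (\<forall>c. \<forall>x\<in>S. c *\<^sub>C x \<in> S) \<and> closed S"

definition bounded_clinear_on ::
    "'a::complex_inner set \<Rightarrow> 'b::complex_inner set \<Rightarrow> ('a \<Rightarrow> 'b) \<Rightarrow> bool"
  where "bounded_clinear_on A B T \<longleftrightarrow>
    (\<forall>x\<in>A. T x \<in> B) \<and>
    (\<forall>x\<in>A. \<forall>y\<in>A. T (x + y) = T x + T y) \<and>
    (\<forall>c. \<forall>x\<in>A. T (c *\<^sub>C x) = c *\<^sub>C T x) \<and>
    (\<exists>K. \<forall>x\<in>A. norm (T x) \<le> K * norm x)"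

text \<open>The adjoint \<open>T\<^sup>*: B \<rightarrow> A\<close> of \<open>T: A \<rightarrow> B\<close>. The codomain \<open>B\<close> is not an argument, because
  \<open>T\<^sup>* y\<close> depends only on \<open>A\<close>, \<open>T\<close> and \<open>y\<close>.\<close>

definition adj_on :: "'a::complex_inner set \<Rightarrow> ('a \<Rightarrow> 'b::complex_inner) \<Rightarrow> 'b \<Rightarrow> 'a"
  where "adj_on A T y = (THE x. x \<in> A \<and> (\<forall>a\<in>A. cinner (T a) y = cinner a x))"

definition corth :: "'a::complex_inner set \<Rightarrow> 'a set"
  where "corth S = {x. \<forall>s\<in>S. cinner s x = 0}"

definition proj_on :: "'a::complex_inner set \<Rightarrow> 'a \<Rightarrow> 'a"
  where "proj_on S x = (THE y. y \<in> S \<and> x - y \<in> corth S)"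

definition positive_on :: "'a::complex_inner set \<Rightarrow> ('a \<Rightarrow> 'a) \<Rightarrow> bool"
  where "positive_on A R \<longleftrightarrow> bounded_clinear_on A A R \<and> (\<forall>x\<in>A. cinner x (R x) \<in> \<real>\<^sub>\<ge>\<^sub>0)"

text \<open>The positive square root of \<open>S\<close> on \<open>A\<close>; it is set to \<open>0\<close> off \<open>A\<close> only in order to be
  unique as a function.\<close>

definition sqrt_on :: "'a::complex_inner set \<Rightarrow> ('a \<Rightarrow> 'a) \<Rightarrow> 'a \<Rightarrow> 'a"
  where "sqrt_on A S =
    (THE R. positive_on A R \<and> (\<forall>x\<in>A. R (R x) = S x) \<and> (\<forall>x. x \<notin> A \<longrightarrow> R x = 0))"


section \<open>Tuples of operators and their minimal isometric dilations\<close>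

text \<open>Below, \<open>L\<close> is a closed subspace and \<open>T j\<close>, for \<open>j\<close> in the finite (nonempty) index type \<open>'d\<close>,
  are operators on \<open>L\<close>.\<close>

definition coisometric :: "'h::chilbert_space set \<Rightarrow> ('d::finite \<Rightarrow> 'h \<Rightarrow> 'h) \<Rightarrow> bool"
  where "coisometric L T \<longleftrightarrow>
    (\<forall>j. bounded_clinear_on L L (T j)) \<and> (\<forall>x\<in>L. (\<Sum>j\<in>UNIV. T j (adj_on L (T j) x)) = x)"

text \<open>The space \<open>H\<^sub>E\<close> of the lifting is the whole type, and \<open>H\<^sub>C\<close> is its closed subspace \<open>HC\<close>.\<close>

definition coisometric_lifting ::
    "'h::chilbert_space set \<Rightarrow> ('d::finite \<Rightarrow> 'h \<Rightarrow> 'h) \<Rightarrow> ('d \<Rightarrow> 'h \<Rightarrow> 'h) \<Rightarrow> bool"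
  where "coisometric_lifting HC C E \<longleftrightarrow>
    coisometric UNIV E \<and>
    (\<forall>j. \<exists>A B. (\<forall>h\<in>HC. B h \<in> corth HC) \<and> (\<forall>k\<in>corth HC. A k \<in> corth HC) \<and>
      (\<forall>h\<in>HC. \<forall>k\<in>corth HC. E j (h + k) = C j h + (B h + A k)))"

definition dsum :: "'h set \<Rightarrow> ('h ^ 'd) set"
  where "dsum L = {x. \<forall>j. x $ j \<in> L}"

definition row_op :: "('d::finite \<Rightarrow> 'h \<Rightarrow> 'h) \<Rightarrow> 'h ^ 'd \<Rightarrow> 'h::chilbert_space"
  where "row_op T x = (\<Sum>j\<in>UNIV. T j (x $ j))"

definition defect_op ::
    "'h::chilbert_space set \<Rightarrow> ('d::finite \<Rightarrow> 'h \<Rightarrow> 'h) \<Rightarrow> 'h ^ 'd \<Rightarrow> 'h ^ 'd"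
  where "defect_op L T = sqrt_on (dsum L) (\<lambda>x. x - adj_on (dsum L) (row_op T) (row_op T x))"

definition defect_space ::
    "'h::chilbert_space set \<Rightarrow> ('d::finite \<Rightarrow> 'h \<Rightarrow> 'h) \<Rightarrow> ('h ^ 'd) set"
  where "defect_space L T = closure (defect_op L T ` dsum L)"

text \<open>\<open>(D\<^sub>T)\<^sub>j\<close>; its adjoint is \<open>adj_on L (defect_comp L T j)\<close>, to be applied to elements of
  \<open>defect_space L T\<close>.\<close>

definition defect_comp ::
    "'h::chilbert_space set \<Rightarrow> ('d::finite \<Rightarrow> 'h \<Rightarrow> 'h) \<Rightarrow> 'd \<Rightarrow> 'h \<Rightarrow> 'h ^ 'd"
  where "defect_comp L T j l = defect_op L T (axis j l)"

text \<open>Words are lists over \<open>'d\<close>. An element \<open>\<Sum>\<alpha>. e\<^sub>\<alpha> \<otimes> d\<^sub>\<alpha>\<close> of the tensor product of the full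
  Fock space with \<open>D\<^sub>T\<close> is the square-summable family \<open>\<alpha> \<mapsto> d\<^sub>\<alpha>\<close> in \<open>D\<^sub>T\<close>.\<close>

definition hat_space ::
    "'h::chilbert_space set \<Rightarrow> ('d::finite \<Rightarrow> 'h \<Rightarrow> 'h) \<Rightarrow> ('h \<times> ('d list, 'h ^ 'd) l2) set"
  where "hat_space L T = {(l, y). l \<in> L \<and> (\<forall>\<alpha>. l2_coord y \<alpha> \<in> defect_space L T)}"

text \<open>\<open>ket \<alpha> d\<close> is \<open>e\<^sub>\<alpha> \<otimes> d\<close>, and \<open>creation j\<close> is tensoring with \<open>e\<^sub>j\<close> from the left.\<close>

definition ket :: "'i \<Rightarrow> 'a::complex_inner \<Rightarrow> ('i, 'a) l2"
  where "ket \<alpha> d = Abs_l2 (\<lambda>\<beta>. if \<beta> = \<alpha> then d else 0)"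

definition creation :: "'d \<Rightarrow> ('d list, 'a::complex_inner) l2 \<Rightarrow> ('d list, 'a) l2"
  where "creation j y =
    Abs_l2 (\<lambda>\<alpha>. case \<alpha> of [] \<Rightarrow> 0 | i # \<beta> \<Rightarrow> if i = j then l2_coord y \<beta> else 0)"

lemma l2_coord_ket: "l2_coord (ket \<alpha> d) \<beta> = (if \<beta> = \<alpha> then d else 0)"
proof -
  have "(\<lambda>\<beta>. (norm (if \<beta> = \<alpha> then d else 0))\<^sup>2) summable_on {\<alpha>}"
    by (rule summable_on_finite) simp
  then have "(\<lambda>\<beta>. (norm (if \<beta> = \<alpha> then d else 0))\<^sup>2) summable_on UNIV"
    by (rule summable_on_cong_neutral[THEN iffD1, rotated -1]) auto
  then show ?thesis
    by (simp add: ket_def l2_coord_Abs_l2)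
qed

lemma l2_coord_creation:
  "l2_coord (creation j y) \<alpha> =
    (case \<alpha> of [] \<Rightarrow> 0 | i # \<beta> \<Rightarrow> if i = j then l2_coord y \<beta> else 0)"
proof -
  let ?f = "\<lambda>\<alpha>. case \<alpha> of [] \<Rightarrow> 0 | i # \<beta> \<Rightarrow> if i = j then l2_coord y \<beta> else 0"
  have "(\<lambda>\<alpha>. (norm (?f \<alpha>))\<^sup>2) summable_on range ((#) j)"
    using l2_summable[of y] by (subst summable_on_reindex) (auto simp: o_def)
  then have "(\<lambda>\<alpha>. (norm (?f \<alpha>))\<^sup>2) summable_on UNIV"
    by (rule summable_on_cong_neutral[THEN iffD1, rotated -1]) (auto split: list.splits)
  then show ?thesis
    by (simp add: creation_def l2_coord_Abs_l2)
qed

definition hat_V ::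
    "'h::chilbert_space set \<Rightarrow> ('d::finite \<Rightarrow> 'h \<Rightarrow> 'h) \<Rightarrow> 'd \<Rightarrow>
      'h \<times> ('d list, 'h ^ 'd) l2 \<Rightarrow> 'h \<times> ('d list, 'h ^ 'd) l2"
  where "hat_V L T j = (\<lambda>(l, y). (T j l, ket [] (defect_comp L T j l) + creation j y))"


section \<open>The unitaries \<open>U\<^sub>n\<close> and the coisometry\<close>

text \<open>The space \<open>L \<otimes> P\<^bsub>[1,n]\<^esub> \<oplus> (\<Oplus>m\<ge>n. (\<complex>\<^sup>d)\<^bsup>\<otimes>m\<^esup> \<otimes> D\<^sub>T)\<close>. The component in \<open>L \<otimes> P\<^bsub>[1,n]\<^esub>\<close>,
  a sum of \<open>h\<^sub>\<alpha> \<otimes> \<epsilon>\<^sub>\<alpha>\<close> over the words \<open>\<alpha>\<close> of length \<open>n\<close>, is represented by the family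
  \<open>\<alpha> \<mapsto> h\<^sub>\<alpha>\<close> supported on those words.\<close>

definition stage_space ::
    "'h::chilbert_space set \<Rightarrow> ('d::finite \<Rightarrow> 'h \<Rightarrow> 'h) \<Rightarrow> nat \<Rightarrow>
      (('d list, 'h) l2 \<times> ('d list, 'h ^ 'd) l2) set"
  where "stage_space L T n = {(g, y).
    (\<forall>\<alpha>. l2_coord g \<alpha> \<in> L) \<and> (\<forall>\<alpha>. length \<alpha> \<noteq> n \<longrightarrow> l2_coord g \<alpha> = 0) \<and>
    (\<forall>\<alpha>. l2_coord y \<alpha> \<in> defect_space L T) \<and> (\<forall>\<alpha>. length \<alpha> < n \<longrightarrow> l2_coord y \<alpha> = 0)}"

text \<open>\<open>U\<^sub>n: stage_space L T (n - 1) \<rightarrow> stage_space L T n\<close>, for \<open>n \<ge> 1\<close>.\<close>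

definition stage_U ::
    "'h::chilbert_space set \<Rightarrow> ('d::finite \<Rightarrow> 'h \<Rightarrow> 'h) \<Rightarrow> nat \<Rightarrow>
      ('d list, 'h) l2 \<times> ('d list, 'h ^ 'd) l2 \<Rightarrow> ('d list, 'h) l2 \<times> ('d list, 'h ^ 'd) l2"
  where "stage_U L T n = (\<lambda>(g, y).
    (Abs_l2 (\<lambda>\<alpha>. if length \<alpha> = n
        then adj_on L (T (last \<alpha>)) (l2_coord g (butlast \<alpha>)) +
             adj_on L (defect_comp L T (last \<alpha>)) (l2_coord y (butlast \<alpha>))
        else 0),
     Abs_l2 (\<lambda>\<alpha>. if length \<alpha> \<ge> n then l2_coord y \<alpha> else 0)))"

text \<open>The canonical unitary from \<open>hat_space L T\<close> onto \<open>stage_space L T 0\<close>, that is, the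
  identification of \<open>L\<close> with \<open>L \<otimes> P\<^bsub>[1,0]\<^esub> = L \<otimes> \<complex>\<close>.\<close>

definition stage_init ::
    "'h::chilbert_space \<times> ('d list, 'h ^ 'd::finite) l2 \<Rightarrow>
      ('d list, 'h) l2 \<times> ('d list, 'h ^ 'd) l2"
  where "stage_init = (\<lambda>(l, y). (ket [] l, y))"

text \<open>\<open>U\<^sub>n \<cdots> U\<^sub>1\<close> and \<open>U\<^sub>1\<^sup>* \<cdots> U\<^sub>n\<^sup>*\<close>, on and to \<open>hat_space L T\<close> respectively.\<close>

primrec U_prod ::
    "'h::chilbert_space set \<Rightarrow> ('d::finite \<Rightarrow> 'h \<Rightarrow> 'h) \<Rightarrow> nat \<Rightarrow>
      'h \<times> ('d list, 'h ^ 'd) l2 \<Rightarrow> ('d list, 'h) l2 \<times> ('d list, 'h ^ 'd) l2"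
  where
    "U_prod L T 0 = stage_init"
  | "U_prod L T (Suc n) = stage_U L T (Suc n) \<circ> U_prod L T n"

primrec U_adj_prod ::
    "'h::chilbert_space set \<Rightarrow> ('d::finite \<Rightarrow> 'h \<Rightarrow> 'h) \<Rightarrow> nat \<Rightarrow>
      ('d list, 'h) l2 \<times> ('d list, 'h ^ 'd) l2 \<Rightarrow> 'h \<times> ('d list, 'h ^ 'd) l2"
  where
    "U_adj_prod L T 0 = adj_on (hat_space L T) stage_init"
  | "U_adj_prod L T (Suc n) =
      U_adj_prod L T n \<circ> adj_on (stage_space L T n) (stage_U L T (Suc n))"

text \<open>\<open>H\<^sub>C \<otimes> P\<^bsub>[1,n]\<^esub>\<close> as a subspace both of \<open>stage_space HC C n\<close> and of \<open>stage_space UNIV E n\<close>.\<close>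

definition chain_space ::
    "'h::chilbert_space set \<Rightarrow> nat \<Rightarrow> (('d::finite list, 'h) l2 \<times> ('d list, 'h ^ 'd) l2) set"
  where "chain_space HC n =
    {(g, y). (\<forall>\<alpha>. l2_coord g \<alpha> \<in> HC) \<and> (\<forall>\<alpha>. length \<alpha> \<noteq> n \<longrightarrow> l2_coord g \<alpha> = 0) \<and> y = 0}"

definition hat_W ::
    "'h::chilbert_space set \<Rightarrow> ('d::finite \<Rightarrow> 'h \<Rightarrow> 'h) \<Rightarrow> ('d \<Rightarrow> 'h \<Rightarrow> 'h) \<Rightarrow>
      'h \<times> ('d list, 'h ^ 'd) l2 \<Rightarrow> 'h \<times> ('d list, 'h ^ 'd) l2"
  where "hat_W HC C E x =
    lim (\<lambda>n. U_adj_prod HC C n (proj_on (chain_space HC n) (U_prod UNIV E n x)))"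

definition hat_W_adj ::
    "'h::chilbert_space set \<Rightarrow> ('d::finite \<Rightarrow> 'h \<Rightarrow> 'h) \<Rightarrow> ('d \<Rightarrow> 'h \<Rightarrow> 'h) \<Rightarrow>
      'h \<times> ('d list, 'h ^ 'd) l2 \<Rightarrow> 'h \<times> ('d list, 'h ^ 'd) l2"
  where "hat_W_adj HC C E = adj_on (hat_space UNIV E) (hat_W HC C E)"

end

theory Submission
  imports Defs
begin

text \<open>The proof computes \<open>hat_W\<close> in coordinates. Two observations make this possible.

  First, a coisometric row operator \<open>T\<close> has \<open>T T\<^sup>* = I\<close>, so \<open>I - T\<^sup>* T\<close> is the projection onto
  its kernel. Hence the defect operator is that projection (\<open>sqrt_on_projection\<close>, \<open>defect_op_eq\<close>),
  the defect space is the kernel, and \<open>(D\<^sub>T)\<^sub>j\<^sup>*\<close> merely reads off the \<open>j\<close>-th coordinate. A vector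
  \<open>l \<oplus> y\<close> of the dilation space is then recorded by its orbit \<open>r\<close>, the family with
  \<open>r(\<emptyset>) = l\<close> and \<open>r(\<alpha> j) = T\<^sub>j\<^sup>* r(\<alpha>) + (y\<^sub>\<alpha>)\<^sub>j\<close>. The product \<open>U\<^sub>n \<cdots> U\<^sub>1\<close> puts the orbit at level
  \<open>n\<close> in place of \<open>l\<close> and of the \<open>y\<^sub>\<alpha>\<close> with \<open>|\<alpha>| < n\<close> (\<open>U_prod_eq\<close>), and its adjoint recovers the
  latter from the former (\<open>U_adj_prod_eq\<close>).

  Second, with \<open>P\<close> the projection onto \<open>H\<^sub>C\<close>, the block form of the lifting amounts to
  \<open>P E\<^sub>j = C\<^sub>j P\<close>. It implies that if \<open>r\<close> is an orbit for \<open>E\<close>, then \<open>P r\<close> is an orbit for \<open>C\<close>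
  (\<open>is_orbit_shadow\<close>), with defect vectors \<open>w\<^sub>\<alpha> = (P r(\<alpha> j) - C\<^sub>j\<^sup>* P r(\<alpha>))\<^sub>j\<close>. So the \<open>n\<close>-th
  approximant of \<open>hat_W (l \<oplus> y)\<close> is \<open>P l\<close> together with the \<open>w\<^sub>\<alpha>\<close> for \<open>|\<alpha>| < n\<close>. Conservation of
  the norm along orbits bounds these vectors by \<open>\<parallel>l \<oplus> y\<parallel>\<close>; therefore \<open>w\<close> is square-summable, the
  limit exists, and \<open>hat_W (l \<oplus> y) = P l \<oplus> w\<close> (\<open>hat_W_eq\<close>).

  In this form \<open>hat_W\<close> visibly commutes with putting a letter in front of all words and with
  stripping the first letter, that is, it intertwines the \<open>V\<^sub>j\<close> (\<open>W_hat_V\<close>) and also their adjoints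
  (\<open>W_hat_V_adj\<close>). The adjoint of the second relation is the second claim of the theorem.\<close>

section \<open>Adjoints and projections in Hilbert spaces\<close>

lemma cinner_add_left: "cinner (x + y) z = cinner x z + cinner y (z :: 'a :: complex_inner)"
  by (metis cinner_add_right cinner_commute complex_cnj_add)

lemma cinner_scaleC_left: "cinner (a *\<^sub>C x) y = cnj a * cinner x (y :: 'a :: complex_inner)"
  by (metis cinner_commute cinner_scaleC_right complex_cnj_mult)

lemma scaleC_zero [simp]: "a *\<^sub>C 0 = (0 :: 'a :: complex_inner)"
  by (metis add_cancel_right_right scaleC_add_right)

lemma scaleC_minus_one: "(-1) *\<^sub>C x = - (x :: 'a :: complex_inner)"
  using scaleR_scaleC[of "-1" x] by simp

lemma bounded_linear_cinner_right: "bounded_linear (cinner (x :: 'a :: complex_inner))"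
proof (rule bounded_linear_intro[where K = "norm x"])
  show "norm (cinner x y) \<le> norm y * norm x" for y
    using norm_cinner_le[of x y] by (simp add: mult.commute)
qed (simp_all add: cinner_add_right scaleR_scaleC cinner_scaleC_right scaleR_conv_of_real)

lemma cinner_zero_right [simp]: "cinner x 0 = (0 :: complex)"
  using bounded_linear_cinner_right linear_simps(3) by blast

lemma cinner_zero_left [simp]: "cinner 0 x = (0 :: complex)"
  by (metis cinner_commute cinner_zero_right complex_cnj_zero)

lemma cinner_diff_right: "cinner x (y - z) = cinner x y - cinner x (z :: 'a :: complex_inner)"
  by (metis (no_types) cinner_add_right diff_add_cancel eq_diff_eq)

lemma cinner_diff_left: "cinner (x - y) z = cinner x z - cinner y (z :: 'a :: complex_inner)"
  by (metis (no_types) cinner_add_left diff_add_cancel eq_diff_eq)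

lemma cinner_sum_left: "cinner (\<Sum>i\<in>I. f i) x = (\<Sum>i\<in>I. cinner (f i) (x :: 'a :: complex_inner))"
  by (induction I rule: infinite_finite_induct) (simp_all add: cinner_add_left)

lemma cinner_sum_right: "cinner x (\<Sum>i\<in>I. f i) = (\<Sum>i\<in>I. cinner x (f i :: 'a :: complex_inner))"
  by (induction I rule: infinite_finite_induct) (simp_all add: cinner_add_right)

lemma cinner_self_eq_0 [simp]: "cinner x x = 0 \<longleftrightarrow> x = (0 :: 'a :: complex_inner)"
  by (simp add: cinner_self)

lemma cinner_eq_0_commute: "cinner x y = 0 \<longleftrightarrow> cinner y (x :: 'a :: complex_inner) = 0"
  using cinner_commute[of x y] by simp

lemma norm_add_sqr: "(norm (x + y))\<^sup>2 = (norm x)\<^sup>2 + (norm y)\<^sup>2 + 2 * Re (cinner x (y :: 'a :: complex_inner))"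
proof -
  have "Re (cinner (x + y) (x + y)) = Re (cinner x x) + Re (cinner y y) + Re (cinner x y) + Re (cinner y x)"
    by (simp add: cinner_add_left cinner_add_right)
  moreover have "Re (cinner y x) = Re (cinner x y)"
    by (subst cinner_commute) simp
  ultimately show ?thesis
    unfolding cinner_self by simp
qed

lemma norm_diff_sqr: "(norm (x - y))\<^sup>2 = (norm x)\<^sup>2 + (norm y)\<^sup>2 - 2 * Re (cinner x (y :: 'a :: complex_inner))"
  using norm_add_sqr[of "x - y" y] by (simp add: cinner_diff_left cinner_self power2_eq_square)

lemma norm_add_orthogonal:
  assumes "cinner x y = 0"
  shows "(norm (x + y :: 'a :: complex_inner))\<^sup>2 = (norm x)\<^sup>2 + (norm y)\<^sup>2"
  using assms by (simp add: norm_add_sqr)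

lemma csubspace_zero: "closed_csubspace S \<Longrightarrow> 0 \<in> S"
  by (simp add: closed_csubspace_def)

lemma csubspace_add: "closed_csubspace S \<Longrightarrow> x \<in> S \<Longrightarrow> y \<in> S \<Longrightarrow> x + y \<in> S"
  by (simp add: closed_csubspace_def)

lemma csubspace_scaleC: "closed_csubspace S \<Longrightarrow> x \<in> S \<Longrightarrow> c *\<^sub>C x \<in> S"
  by (simp add: closed_csubspace_def)

lemma csubspace_scaleR: "closed_csubspace S \<Longrightarrow> x \<in> S \<Longrightarrow> r *\<^sub>R x \<in> S"
  by (simp add: scaleR_scaleC csubspace_scaleC)

lemma csubspace_diff: "closed_csubspace S \<Longrightarrow> x \<in> S \<Longrightarrow> y \<in> S \<Longrightarrow> x - y \<in> S"
  using csubspace_add[of S x "- y"] csubspace_scaleC[of S y "-1"] by (simp add: scaleC_minus_one)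

lemma csubspace_sum:
  assumes "closed_csubspace S" "\<And>i. i \<in> I \<Longrightarrow> f i \<in> S"
  shows "(\<Sum>i\<in>I. f i) \<in> S"
  using assms(2) by (induction I rule: infinite_finite_induct)
    (simp_all add: csubspace_zero csubspace_add assms(1))

lemma closed_csubspace_UNIV [simp]: "closed_csubspace UNIV"
  by (simp add: closed_csubspace_def)

lemma closed_csubspace_corth: "closed_csubspace (corth S)"
proof -
  have "corth S = (\<Inter>s\<in>S. {x. cinner s x = 0})"
    by (auto simp: corth_def)
  moreover have "closed {x. cinner s x = 0}" for s :: 'a
    by (intro closed_Collect_eq continuous_intros
        linear_continuous_on bounded_linear_cinner_right)
  ultimately have "closed (corth S)" by auto
  then show ?thesis
    by (simp add: closed_csubspace_def corth_def cinner_add_right cinner_scaleC_right)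
qed

lemma csubspace_orthogonal_eq_0:
  assumes "x \<in> S" "\<And>a. a \<in> S \<Longrightarrow> cinner a x = 0"
  shows "x = 0"
  using assms(2)[OF assms(1)] by simp

text \<open>The Riesz representation theorem in its variational form: the representing vector
  minimises \<open>\<parallel>a\<parallel>\<^sup>2 - 2 f a\<close>. By the parallelogram law minimising sequences are Cauchy, and
  at the minimum the derivative in every direction vanishes.\<close>

lemma riesz_real:
  fixes f :: "'a::chilbert_space \<Rightarrow> real"
  assumes A: "closed_csubspace A"
    and add: "\<And>x y. x \<in> A \<Longrightarrow> y \<in> A \<Longrightarrow> f (x + y) = f x + f y"
    and scale: "\<And>r x. x \<in> A \<Longrightarrow> f (r *\<^sub>R x) = r * f x"
    and bound: "\<And>x. x \<in> A \<Longrightarrow> \<bar>f x\<bar> \<le> K * norm x"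
  obtains x where "x \<in> A" "\<And>a. a \<in> A \<Longrightarrow> f a = Re (cinner a x)"
proof -
  define \<phi> where "\<phi> a = (norm a)\<^sup>2 - 2 * f a" for a
  define m where "m = Inf (\<phi> ` A)"
  note in_A = csubspace_zero[OF A] csubspace_add[OF A] csubspace_scaleR[OF A] csubspace_diff[OF A]
  have below: "- K\<^sup>2 \<le> \<phi> a" if "a \<in> A" for a
  proof -
    have "f a \<le> K * norm a"
      using bound[OF that] by linarith
    then show ?thesis
      using sum_squares_bound[of K "norm a"] by (simp add: \<phi>_def power2_eq_square)
  qed
  then have bdd: "bdd_below (\<phi> ` A)" by (rule bdd_belowI2)
  have m_le: "m \<le> \<phi> a" if "a \<in> A" for a
    unfolding m_def using bdd that by (rule cINF_lower)
  have "\<exists>a\<in>A. \<phi> a < m + 1 / Suc n" for n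
  proof -
    have "Inf (\<phi> ` A) < m + 1 / Suc n" by (simp add: m_def)
    then show ?thesis using in_A(1) bdd by (subst (asm) cINF_less_iff) auto
  qed
  then obtain a where a: "\<And>n. a n \<in> A" and a_less: "\<And>n. \<phi> (a n) < m + 1 / Suc n"
    by metis
  \<comment> \<open>The midpoint of \<open>u\<close> and \<open>v\<close> also has \<open>\<phi> \<ge> m\<close>, so near-minimisers are close together.\<close>
  have parallelogram: "(norm (u - v))\<^sup>2 \<le> 2 * (\<phi> u - m) + 2 * (\<phi> v - m)"
    if u: "u \<in> A" and v: "v \<in> A" for u v
  proof -
    let ?c = "(1/2) *\<^sub>R (u + v)"
    have f: "f ?c = (f u + f v) / 2"
      using u v by (simp add: scale add in_A)
    have "(norm ?c)\<^sup>2 = (norm (u + v))\<^sup>2 / 4"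
      unfolding norm_scaleR by (simp add: power_divide)
    then have "4 * (norm ?c)\<^sup>2 + (norm (u - v))\<^sup>2 = 2 * (norm u)\<^sup>2 + 2 * (norm v)\<^sup>2"
      using norm_add_sqr[of u v] norm_diff_sqr[of u v] by linarith
    moreover have "m \<le> \<phi> ?c"
      by (intro m_le in_A u v)
    ultimately show ?thesis
      unfolding \<phi>_def f by argo
  qed
  have "Cauchy a"
  proof (rule CauchyI)
    fix e :: real assume e: "0 < e"
    define M where "M = nat \<lceil>4 / e\<^sup>2\<rceil>"
    have M: "4 / e\<^sup>2 < Suc M" unfolding M_def by linarith
    have small: "1 / Suc n < e\<^sup>2 / 4" if "n \<ge> M" for n
    proof -
      have "4 / e\<^sup>2 < Suc n" using M that by linarith
      then show ?thesis using e by (simp add: field_simps)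
    qed
    have "norm (a k - a n) < e" if "k \<ge> M" "n \<ge> M" for k n
    proof -
      have "(norm (a k - a n))\<^sup>2 < e\<^sup>2"
        using parallelogram[OF a a, of k n] a_less[of k] a_less[of n] small[OF that(1)] small[OF that(2)]
        by argo
      then show ?thesis using e by (simp add: power2_less_imp_less)
    qed
    then show "\<exists>M. \<forall>m\<ge>M. \<forall>n\<ge>M. norm (a m - a n) < e" by blast
  qed
  then obtain x where lim: "a \<longlonglongrightarrow> x"
    using Cauchy_convergent_iff convergent_def by blast
  have x: "x \<in> A"
    using A a lim unfolding closed_csubspace_def by (meson closed_sequentially)
  have "(\<lambda>n. f (a n)) \<longlonglongrightarrow> f x"
  proof (rule Lim_transform_bound[THEN LIM_zero_cancel, rotated])
    show "(\<lambda>n. K * norm (a n - x)) \<longlonglongrightarrow> 0"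
      using tendsto_mult_right_zero[OF tendsto_norm_zero[OF LIM_zero[OF lim]]] .
    have "f (a n) = f (a n - x) + f x" for n
      using add[of "a n - x" x] a x by (simp add: in_A)
    then have "norm (f (a n) - f x) \<le> norm (K * norm (a n - x))" for n
      using bound[OF in_A(4)[OF a x], of n] by simp
    then show "\<forall>\<^sub>F n in sequentially. norm (f (a n) - f x) \<le> norm (K * norm (a n - x))"
      by simp
  qed
  then have "(\<lambda>n. \<phi> (a n)) \<longlonglongrightarrow> \<phi> x"
    unfolding \<phi>_def by (intro tendsto_intros lim)
  moreover have "(\<lambda>n. m + 1 / Suc n) \<longlonglongrightarrow> m + 0"
    by (intro tendsto_intros LIMSEQ_Suc[OF lim_1_over_n])
  ultimately have "\<phi> x \<le> m + 0"
    by (rule LIMSEQ_le) (use a_less less_imp_le in blast)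
  then have min: "\<phi> x \<le> \<phi> u" if "u \<in> A" for u
    using m_le[OF that] by simp
  show thesis
  proof (rule that[OF x])
    fix b assume b: "b \<in> A"
    \<comment> \<open>The derivative of \<open>\<phi>\<close> at \<open>x\<close> in the direction \<open>b\<close> is \<open>2 c\<close>. The step \<open>- c / N\<close> would decrease
      \<open>\<phi>\<close> if \<open>c \<noteq> 0\<close>; adding \<open>1\<close> to the norm square keeps \<open>N\<close> away from zero when \<open>b = 0\<close>.\<close>
    define c where "c = Re (cinner x b) - f b"
    define N where "N = (norm b)\<^sup>2 + 1"
    have N: "1 \<le> N" by (simp add: N_def)
    have "0 \<le> t\<^sup>2 * (norm b)\<^sup>2 + 2 * t * c" for t
    proof -
      have "Re (cinner x (t *\<^sub>R b)) = t * Re (cinner x b)"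
        by (simp add: scaleR_scaleC cinner_scaleC_right)
      then have "(norm (x + t *\<^sub>R b))\<^sup>2 = (norm x)\<^sup>2 + t\<^sup>2 * (norm b)\<^sup>2 + 2 * t * Re (cinner x b)"
        by (simp add: norm_add_sqr power_mult_distrib)
      moreover have "f (x + t *\<^sub>R b) = f x + t * f b"
        using x b by (simp add: add scale in_A)
      moreover have "\<phi> x \<le> \<phi> (x + t *\<^sub>R b)"
        using x b by (simp add: min in_A)
      ultimately show ?thesis
        by (simp add: \<phi>_def c_def algebra_simps)
    qed
    from this[of "- c / N"] have "0 \<le> c\<^sup>2 * ((norm b)\<^sup>2 - 2 * N) / N\<^sup>2"
      using N by (simp add: power2_eq_square field_simps)
    then have "0 \<le> c\<^sup>2 * ((norm b)\<^sup>2 - 2 * N)"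
      using N by (simp add: zero_le_divide_iff)
    moreover have "(norm b)\<^sup>2 - 2 * N < 0"
      using zero_le_power2[of "norm b"] unfolding N_def by argo
    ultimately have "c = 0"
      by (simp add: zero_le_mult_iff)
    then show "f b = Re (cinner b x)"
      unfolding c_def by (subst cinner_commute) simp
  qed
qed

lemma adj_on_eqI:
  assumes A: "closed_csubspace A" and x: "x \<in> A"
    and eq: "\<And>a. a \<in> A \<Longrightarrow> cinner (T a) y = cinner a x"
  shows "adj_on A T y = x"
  unfolding adj_on_def
proof (rule the_equality)
  fix z assume z: "z \<in> A \<and> (\<forall>a\<in>A. cinner (T a) y = cinner a z)"
  then have "z - x \<in> A" "\<And>a. a \<in> A \<Longrightarrow> cinner a (z - x) = 0"
    using x eq by (auto simp: csubspace_diff[OF A] cinner_diff_right)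
  then show "z = x"
    using csubspace_orthogonal_eq_0 by fastforce
qed (use x eq in auto)

text \<open>The adjoint of a bounded operator exists, by applying the Riesz theorem to the real part of
  \<open>a \<mapsto> \<langle>T a, y\<rangle>\<close>.\<close>

lemma
  fixes T :: "'a::chilbert_space \<Rightarrow> 'b::complex_inner"
  assumes A: "closed_csubspace A" and T: "bounded_clinear_on A B T"
  shows adj_on_in: "adj_on A T y \<in> A"
    and cinner_adj_on: "a \<in> A \<Longrightarrow> cinner (T a) y = cinner a (adj_on A T y)"
proof -
  obtain K where K: "\<And>x. x \<in> A \<Longrightarrow> norm (T x) \<le> K * norm x"
    using T unfolding bounded_clinear_on_def by blast
  have scaleC: "T (c *\<^sub>C x) = c *\<^sub>C T x" if "x \<in> A" for c x
    using T that unfolding bounded_clinear_on_def by auto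
  have bound: "\<bar>Re (cinner (T x) y)\<bar> \<le> (K * norm y) * norm x" if "x \<in> A" for x
  proof -
    have "\<bar>Re (cinner (T x) y)\<bar> \<le> norm (T x) * norm y"
      using abs_Re_le_cmod norm_cinner_le order_trans by blast
    also have "\<dots> \<le> K * norm x * norm y"
      by (intro mult_right_mono K that) simp
    finally show ?thesis by (simp add: mult_ac)
  qed
  obtain x where x: "x \<in> A" and eq: "\<And>a. a \<in> A \<Longrightarrow> Re (cinner (T a) y) = Re (cinner a x)"
  proof (rule riesz_real[OF A, of "\<lambda>a. Re (cinner (T a) y)"])
    show "Re (cinner (T (u + v)) y) = Re (cinner (T u) y) + Re (cinner (T v) y)"
      if "u \<in> A" "v \<in> A" for u v
      using T that by (auto simp: bounded_clinear_on_def cinner_add_left)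
    show "Re (cinner (T (r *\<^sub>R u)) y) = r * Re (cinner (T u) y)" if "u \<in> A" for r u
      using that by (simp add: scaleC scaleR_scaleC cinner_scaleC_left)
  qed (use bound in auto)
  \<comment> \<open>Applying the identity of real parts to \<open>\<i> a\<close> gives that of the imaginary parts.\<close>
  have "cinner (T a) y = cinner a x" if "a \<in> A" for a
    using eq[OF that] eq[OF csubspace_scaleC[OF A that, of \<i>]]
    by (simp add: scaleC[OF that] cinner_scaleC_left complex_eq_iff)
  then have "adj_on A T y = x" "\<And>a. a \<in> A \<Longrightarrow> cinner (T a) y = cinner a x"
    using adj_on_eqI[OF A x] by auto
  then show "adj_on A T y \<in> A" "a \<in> A \<Longrightarrow> cinner (T a) y = cinner a (adj_on A T y)"
    using x by auto
qed

lemma adj_on_add: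
  fixes T :: "'a::chilbert_space \<Rightarrow> 'b::complex_inner"
  assumes "closed_csubspace A" and "bounded_clinear_on A B T"
  shows "adj_on A T (x + y) = adj_on A T x + adj_on A T y"
  using assms by (intro adj_on_eqI)
    (simp_all add: csubspace_add adj_on_in[OF assms] cinner_adj_on[OF assms] cinner_add_right)

lemma adj_on_scaleC:
  fixes T :: "'a::chilbert_space \<Rightarrow> 'b::complex_inner"
  assumes "closed_csubspace A" and "bounded_clinear_on A B T"
  shows "adj_on A T (c *\<^sub>C x) = c *\<^sub>C adj_on A T x"
  using assms by (intro adj_on_eqI)
    (simp_all add: csubspace_scaleC adj_on_in[OF assms] cinner_adj_on[OF assms] cinner_scaleC_right)

lemma adj_on_zero: "closed_csubspace A \<Longrightarrow> adj_on A T 0 = 0"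
  by (intro adj_on_eqI) (simp_all add: csubspace_zero)

lemma proj_on_eqI:
  assumes S: "closed_csubspace S" and y: "y \<in> S" "x - y \<in> corth S"
  shows "proj_on S x = y"
  unfolding proj_on_def
proof (rule the_equality)
  fix z assume z: "z \<in> S \<and> x - z \<in> corth S"
  then have "(x - y) - (x - z) \<in> corth S"
    using y csubspace_diff[OF closed_csubspace_corth] by blast
  moreover have "z - y \<in> S"
    using S y z by (simp add: csubspace_diff)
  ultimately show "z = y"
    using csubspace_orthogonal_eq_0[of "z - y" S] by (simp add: corth_def)
qed (use y in auto)

text \<open>The orthogonal projection is the adjoint of the inclusion, which settles its existence.\<close>

lemma
  fixes S :: "'a::chilbert_space set"
  assumes S: "closed_csubspace S"
  shows proj_on_in: "proj_on S x \<in> S"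
    and diff_proj_on_in: "x - proj_on S x \<in> corth S"
proof -
  have inclusion: "bounded_clinear_on S UNIV (\<lambda>a. a)"
    by (auto simp: bounded_clinear_on_def intro!: exI[of _ 1])
  let ?y = "adj_on S (\<lambda>a. a) x"
  have "cinner a (x - ?y) = 0" if "a \<in> S" for a
    using cinner_adj_on[OF S inclusion that, of x] by (simp add: cinner_diff_right)
  then have y: "?y \<in> S" "x - ?y \<in> corth S"
    using adj_on_in[OF S inclusion, of x] by (auto simp: corth_def)
  from y proj_on_eqI[OF S y] show "proj_on S x \<in> S" "x - proj_on S x \<in> corth S"
    by auto
qed

lemma proj_on_add:
  fixes S :: "'a::chilbert_space set"
  assumes "closed_csubspace S"
  shows "proj_on S (x + y) = proj_on S x + proj_on S y"
  using assms csubspace_add[OF closed_csubspace_corth diff_proj_on_in[of S x] diff_proj_on_in[of S y]]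
  by (intro proj_on_eqI) (simp_all add: csubspace_add proj_on_in algebra_simps)

lemma proj_on_scaleC:
  fixes S :: "'a::chilbert_space set"
  assumes S: "closed_csubspace S"
  shows "proj_on S (c *\<^sub>C x) = c *\<^sub>C proj_on S x"
proof (rule proj_on_eqI[OF S])
  have "c *\<^sub>C x - c *\<^sub>C proj_on S x = c *\<^sub>C (x - proj_on S x)"
    using scaleC_add_right[of c "x - proj_on S x" "proj_on S x"] by (simp add: algebra_simps)
  then show "c *\<^sub>C x - c *\<^sub>C proj_on S x \<in> corth S"
    by (simp add: csubspace_scaleC[OF closed_csubspace_corth] diff_proj_on_in S)
qed (simp add: S csubspace_scaleC proj_on_in)

lemma proj_on_zero: "closed_csubspace S \<Longrightarrow> proj_on S 0 = 0"
  by (intro proj_on_eqI) (simp_all add: csubspace_zero closed_csubspace_corth)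

lemma norm_proj_on_le:
  fixes S :: "'a::chilbert_space set"
  assumes "closed_csubspace S"
  shows "(norm (proj_on S x))\<^sup>2 \<le> (norm x)\<^sup>2"
proof -
  have "cinner (proj_on S x) (x - proj_on S x) = 0"
    using proj_on_in[OF assms] diff_proj_on_in[OF assms] by (auto simp: corth_def)
  from norm_add_orthogonal[OF this] show ?thesis by simp
qed



section \<open>The defect operator of a coisometric tuple\<close>

text \<open>If \<open>z = R k\<close> were nonzero with \<open>R z = 0\<close>, then \<open>\<langle>k + t z, R (k + t z)\<rangle> = \<langle>k, z\<rangle> + t \<parallel>z\<parallel>\<^sup>2\<close>
  would have a negative real part for suitable \<open>t\<close>.\<close>

lemma positive_on_square_zero:
  assumes A: "closed_csubspace A" and R: "positive_on A R" and k: "k \<in> A" "R (R k) = 0"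
  shows "R k = 0"
proof (rule ccontr)
  assume "R k \<noteq> 0"
  define z where "z = R k"
  have z: "z \<in> A" "R z = 0" "0 < (norm z)\<^sup>2"
    using R k \<open>R k \<noteq> 0\<close> by (auto simp: z_def positive_on_def bounded_clinear_on_def)
  \<comment> \<open>The value for which the real part of the quadratic form is \<open>-1\<close>.\<close>
  define t where "t = - (Re (cinner k z) + 1) / (norm z)\<^sup>2"
  have "k + complex_of_real t *\<^sub>C z \<in> A" (is "?x \<in> A")
    using A k z by (simp add: csubspace_add csubspace_scaleC)
  then have "cinner ?x (R ?x) \<in> \<real>\<^sub>\<ge>\<^sub>0"
    using R by (auto simp: positive_on_def)
  moreover have "R ?x = z"
    using R k z csubspace_scaleC[OF A z(1)] by (simp add: positive_on_def bounded_clinear_on_def z_def)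
  ultimately have "0 \<le> Re (cinner k z) + t * (norm z)\<^sup>2"
    by (simp add: cinner_add_left cinner_scaleC_left cinner_self complex_nonneg_Reals_iff)
  then show False
    using z(3) by (simp add: t_def)
qed

text \<open>A positive square root \<open>R\<close> of a projection \<open>S\<close> vanishes on the kernel of \<open>S\<close>. On the range
  of \<open>S\<close> it is a positive involution, and a vector \<open>R u - u\<close> there would be an eigenvector for the
  eigenvalue \<open>-1\<close>; hence \<open>R\<close> is the identity on the range.\<close>

lemma sqrt_on_projection:
  assumes A: "closed_csubspace A" and S: "positive_on A S"
    and idem: "\<And>x. x \<in> A \<Longrightarrow> S (S x) = S x" and x: "x \<in> A"
  shows "sqrt_on A S x = S x"
proof -
  have S_in: "S x \<in> A" if "x \<in> A" for x
    using S that by (auto simp: positive_on_def bounded_clinear_on_def)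
  have S_diff: "S (x - y) = S x - S y" if "x \<in> A" "y \<in> A" for x y
  proof -
    have "S (x - y + y) = S (x - y) + S y"
      using S that csubspace_diff[OF A that] unfolding positive_on_def bounded_clinear_on_def by blast
    then show ?thesis by simp
  qed
  let ?R = "\<lambda>x. if x \<in> A then S x else 0"
  have "sqrt_on A S = ?R"
    unfolding sqrt_on_def
  proof (rule the_equality)
    have "positive_on A ?R"
      using S csubspace_add[OF A] csubspace_scaleC[OF A]
      by (auto simp: positive_on_def bounded_clinear_on_def)
    then show "positive_on A ?R \<and> (\<forall>x\<in>A. ?R (?R x) = S x) \<and> (\<forall>x. x \<notin> A \<longrightarrow> ?R x = 0)"
      using idem S_in by auto
  next
    fix R assume R: "positive_on A R \<and> (\<forall>x\<in>A. R (R x) = S x) \<and> (\<forall>x. x \<notin> A \<longrightarrow> R x = 0)"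
    have R_in: "R x \<in> A" and R_add: "y \<in> A \<Longrightarrow> R (x + y) = R x + R y" if "x \<in> A" for x y
      using R that by (auto simp: positive_on_def bounded_clinear_on_def)
    have R_diff: "R (x - y) = R x - R y" if "x \<in> A" "y \<in> A" for x y
      using R_add[of "x - y" y] that csubspace_diff[OF A that] by simp
    have "R x = S x" if x: "x \<in> A" for x
    proof -
      let ?u = "S x"
      note u = S_in[OF x]
      have k: "x - ?u \<in> A"
        using A x u by (simp add: csubspace_diff)
      have "R (R (x - ?u)) = 0"
        using R k x u by (simp add: S_diff idem)
      then have Rk: "R (x - ?u) = 0"
        using R k positive_on_square_zero[OF A] by blast
      let ?v = "R ?u - ?u"
      have v: "?v \<in> A"
        using A u by (simp add: csubspace_diff R_in)
      have "R ?v = - ?v"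
        using R u x by (simp add: R_diff R_in idem)
      moreover have "cinner ?v (R ?v) \<in> \<real>\<^sub>\<ge>\<^sub>0"
        using R v by (auto simp: positive_on_def)
      moreover have "cinner ?v (- ?v) = - complex_of_real ((norm ?v)\<^sup>2)"
        using cinner_diff_right[of ?v 0 ?v] by (simp only: cinner_zero_right cinner_self) simp
      ultimately have "?v = 0"
        by (simp add: complex_nonneg_Reals_iff)
      then show ?thesis
        using R_diff[OF x u] Rk by simp
    qed
    then show "R = ?R"
      using R by auto
  qed
  then show ?thesis using x by simp
qed

locale coisometric_tuple =
  fixes L :: "'h::chilbert_space set" and T :: "'d::finite \<Rightarrow> 'h \<Rightarrow> 'h"
  assumes subspace: "closed_csubspace L" and coisometric: "coisometric L T"
begin

abbreviation T_adj :: "'d \<Rightarrow> 'h \<Rightarrow> 'h" where "T_adj j \<equiv> adj_on L (T j)"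

lemma bounded_clinear_T: "bounded_clinear_on L L (T j)"
  using coisometric by (simp add: coisometric_def)

lemma T_in: "l \<in> L \<Longrightarrow> T j l \<in> L"
  using bounded_clinear_T[of j] by (auto simp: bounded_clinear_on_def)

lemma T_add: "l \<in> L \<Longrightarrow> m \<in> L \<Longrightarrow> T j (l + m) = T j l + T j m"
  using bounded_clinear_T[of j] by (auto simp: bounded_clinear_on_def)

lemma T_scaleC: "l \<in> L \<Longrightarrow> T j (c *\<^sub>C l) = c *\<^sub>C T j l"
  using bounded_clinear_T[of j] by (auto simp: bounded_clinear_on_def)

lemma T_diff: "l \<in> L \<Longrightarrow> m \<in> L \<Longrightarrow> T j (l - m) = T j l - T j m"
  using T_add[of "l - m" m] csubspace_diff[OF subspace] by simp

lemma T_zero: "T j 0 = 0"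
  using T_diff[of 0 0] csubspace_zero[OF subspace] by simp

lemma T_adj_in: "T_adj j y \<in> L"
  using adj_on_in[OF subspace bounded_clinear_T] .

lemma cinner_T_left: "l \<in> L \<Longrightarrow> cinner (T j l) y = cinner l (T_adj j y)"
  using cinner_adj_on[OF subspace bounded_clinear_T] .

lemma cinner_T_right: "l \<in> L \<Longrightarrow> cinner y (T j l) = cinner (T_adj j y) l"
  using cinner_T_left[of l j y] cinner_commute[of y] cinner_commute[of l] by simp

lemmas T_adj_add = adj_on_add[OF subspace bounded_clinear_T]
lemmas T_adj_scaleC = adj_on_scaleC[OF subspace bounded_clinear_T]
lemmas T_adj_zero = adj_on_zero[OF subspace, of "T j" for j]

lemma sum_T_T_adj: "l \<in> L \<Longrightarrow> (\<Sum>j\<in>UNIV. T j (T_adj j l)) = l"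
  using coisometric by (simp add: coisometric_def)

lemma closed_csubspace_dsum: "closed_csubspace (dsum L :: ('h ^ 'd) set)"
proof -
  have "(dsum L :: ('h ^ 'd) set) = (\<Inter>j. (\<lambda>x. x $ j) -` L)"
    by (auto simp: dsum_def)
  moreover have "closed ((\<lambda>x :: 'h ^ 'd. x $ j) -` L)" for j
    using subspace by (intro closed_vimage continuous_intros) (simp add: closed_csubspace_def)
  ultimately have "closed (dsum L :: ('h ^ 'd) set)" by auto
  then show ?thesis
    using subspace by (simp add: closed_csubspace_def dsum_def scaleC_vec_def)
qed

definition row_adj :: "'h \<Rightarrow> 'h ^ 'd" where "row_adj l = (\<chi> j. T_adj j l)"

lemma row_adj_nth [simp]: "row_adj l $ j = T_adj j l"
  by (simp add: row_adj_def)

lemma row_adj_in: "row_adj l \<in> dsum L"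
  by (simp add: dsum_def T_adj_in)

lemma row_op_in: "x \<in> dsum L \<Longrightarrow> row_op T x \<in> L"
  unfolding row_op_def by (intro csubspace_sum[OF subspace]) (simp add: dsum_def T_in)

lemma row_op_diff: "x \<in> dsum L \<Longrightarrow> y \<in> dsum L \<Longrightarrow> row_op T (x - y) = row_op T x - row_op T y"
  by (simp add: row_op_def dsum_def T_diff sum_subtractf)

lemma row_op_row_adj: "l \<in> L \<Longrightarrow> row_op T (row_adj l) = l"
  by (simp add: row_op_def sum_T_T_adj)

lemma cinner_row_adj_left: "x \<in> dsum L \<Longrightarrow> cinner (row_adj l) x = cinner l (row_op T x)"
  by (simp add: cinner_vec_def row_op_def dsum_def cinner_sum_right cinner_T_right)

lemma cinner_row_adj_right: "x \<in> dsum L \<Longrightarrow> cinner x (row_adj l) = cinner (row_op T x) l"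
  by (simp add: cinner_vec_def row_op_def dsum_def cinner_sum_left cinner_T_left)

lemma adj_row_op: "adj_on (dsum L) (row_op T) l = row_adj l"
  by (intro adj_on_eqI closed_csubspace_dsum row_adj_in) (simp add: cinner_row_adj_right)

text \<open>For a coisometric tuple \<open>I - T\<^sup>* T\<close> is the orthogonal projection onto the kernel of the row
  operator. It is therefore its own square root, and the defect space is that kernel.\<close>

lemma defect_op_eq:
  assumes x: "x \<in> dsum L"
  shows "defect_op L T x = x - row_adj (row_op T x)"
proof -
  let ?D = "\<lambda>x. x - row_adj (row_op T x)"
  have D_in: "?D x \<in> dsum L" if "x \<in> dsum L" for x
    using that by (simp add: csubspace_diff[OF closed_csubspace_dsum] row_adj_in)
  have row_D: "row_op T (?D x) = 0" if "x \<in> dsum L" for x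
    using that by (simp add: row_op_diff row_adj_in row_op_row_adj row_op_in)
  have orth: "cinner (?D x) (row_adj l) = 0" if "x \<in> dsum L" for x l
    using cinner_row_adj_right[OF D_in[OF that], of l] row_D[OF that] by simp
  have bound: "norm (?D x) \<le> norm x" if "x \<in> dsum L" for x
  proof (rule power2_le_imp_le)
    show "(norm (?D x))\<^sup>2 \<le> (norm x)\<^sup>2"
      using norm_add_orthogonal[OF orth[OF that, of "row_op T x"]] unfolding diff_add_cancel
      by (metis le_add_same_cancel1 zero_le_power2)
  qed simp
  have quadratic: "cinner x (?D x) = complex_of_real ((norm (?D x))\<^sup>2)" if "x \<in> dsum L" for x
  proof -
    have "cinner (row_adj (row_op T x)) (?D x) = 0"
      using orth[OF that] cinner_eq_0_commute by blast
    then show ?thesis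
      using cinner_diff_left[of x "row_adj (row_op T x)" "?D x"] unfolding cinner_self by simp
  qed
  have row_add: "row_op T (x + y) = row_op T x + row_op T y" if "x \<in> dsum L" "y \<in> dsum L" for x y
    using that by (simp add: row_op_def dsum_def T_add sum.distrib)
  have row_scaleC: "row_op T (c *\<^sub>C x) = c *\<^sub>C row_op T x" if "x \<in> dsum L" for c x
  proof -
    have "(\<Sum>j\<in>J. c *\<^sub>C T j (x $ j)) = c *\<^sub>C (\<Sum>j\<in>J. T j (x $ j))" for J
      by (induction J rule: infinite_finite_induct) (simp_all add: scaleC_add_right)
    then show ?thesis
      using that by (simp add: row_op_def dsum_def T_scaleC scaleC_vec_def)
  qed
  have scaleC_diff: "c *\<^sub>C (a - b) = c *\<^sub>C a - c *\<^sub>C b" for c and a b :: "'h ^ 'd"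
    using scaleC_add_right[of c "a - b" b] by (simp add: algebra_simps)
  have adj_add: "row_adj (a + b) = row_adj a + row_adj b" for a b
    by (simp add: vec_eq_iff T_adj_add)
  have adj_scaleC: "row_adj (c *\<^sub>C a) = c *\<^sub>C row_adj a" for a c
    by (simp add: vec_eq_iff T_adj_scaleC scaleC_vec_def)
  have "bounded_clinear_on (dsum L) (dsum L) ?D"
    unfolding bounded_clinear_on_def
    using bound D_in by (auto simp: row_add row_scaleC adj_add adj_scaleC scaleC_diff intro!: exI[of _ 1])
  then have "positive_on (dsum L) ?D"
    unfolding positive_on_def using quadratic by simp
  moreover have "?D (?D x) = ?D x" if "x \<in> dsum L" for x
    using that by (simp add: row_D vec_eq_iff T_adj_zero)
  ultimately have "sqrt_on (dsum L) ?D x = ?D x"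
    by (intro sqrt_on_projection closed_csubspace_dsum x)
  then show ?thesis
    by (simp add: defect_op_def adj_row_op)
qed

text \<open>The range of the defect operator is already closed: inside \<open>dsum L\<close> it is the orthogonal
  complement of the range of \<open>T\<^sup>*\<close>.\<close>

lemma defect_space_eq: "defect_space L T = {x \<in> dsum L. row_op T x = 0}"
proof -
  have "defect_op L T ` dsum L = {x \<in> dsum L. row_op T x = 0}"
  proof (intro equalityI subsetI)
    fix x assume "x \<in> defect_op L T ` dsum L"
    then obtain y where "y \<in> dsum L" "x = y - row_adj (row_op T y)"
      by (auto simp: defect_op_eq)
    then show "x \<in> {x \<in> dsum L. row_op T x = 0}"
      by (simp add: csubspace_diff[OF closed_csubspace_dsum] row_adj_in row_op_diff row_op_row_adj row_op_in)
  next
    fix x assume x: "x \<in> {x \<in> dsum L. row_op T x = 0}"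
    then have "defect_op L T x = x"
      by (simp add: defect_op_eq vec_eq_iff T_adj_zero)
    then show "x \<in> defect_op L T ` dsum L"
      using x by force
  qed
  moreover have "{x \<in> dsum L. row_op T x = 0} = dsum L \<inter> corth (range row_adj)"
  proof -
    have "row_op T x = 0 \<longleftrightarrow> (\<forall>l. cinner (row_adj l) x = 0)" if "x \<in> dsum L" for x
    proof
      assume "\<forall>l. cinner (row_adj l) x = 0"
      then have "cinner (row_op T x) (row_op T x) = 0"
        using cinner_row_adj_left[OF that] by metis
      then show "row_op T x = 0" by simp
    qed (simp add: cinner_row_adj_left[OF that])
    then show ?thesis by (auto simp: corth_def)
  qed
  moreover have "closed (dsum L \<inter> corth (range row_adj))"
    using closed_csubspace_dsum closed_csubspace_corth by (auto simp: closed_csubspace_def)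
  ultimately show ?thesis
    by (simp add: defect_space_def closure_closed)
qed

lemma closed_csubspace_defect_space: "closed_csubspace (defect_space L T)"
proof -
  have "closed (defect_space L T)" by (simp add: defect_space_def)
  moreover have "(\<Sum>j\<in>J. c *\<^sub>C T j (x $ j)) = c *\<^sub>C (\<Sum>j\<in>J. T j (x $ j))" for J c and x :: "'h ^ 'd"
    by (induction J rule: infinite_finite_induct) (simp_all add: scaleC_add_right)
  ultimately show ?thesis
    using subspace unfolding closed_csubspace_def defect_space_eq dsum_def row_op_def
    by (auto simp: T_zero T_add T_scaleC sum.distrib scaleC_vec_def)
qed

lemma sum_T_defect: "d \<in> defect_space L T \<Longrightarrow> (\<Sum>j\<in>UNIV. T j (d $ j)) = 0"
  by (simp add: defect_space_eq row_op_def)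

lemma defect_nth_in: "d \<in> defect_space L T \<Longrightarrow> d $ j \<in> L"
  by (simp add: defect_space_eq dsum_def)

lemma defect_comp_eq:
  assumes "l \<in> L"
  shows "defect_comp L T j l = axis j l - row_adj (T j l)"
proof -
  have axis: "axis j l \<in> dsum L"
    using assms csubspace_zero[OF subspace] by (auto simp: dsum_def axis_def)
  have "row_op T (axis j l) = (\<Sum>i\<in>UNIV. if i = j then T j l else 0)"
    unfolding row_op_def by (rule sum.cong) (auto simp: axis_def T_zero)
  then have "row_op T (axis j l) = T j l" by simp
  then show ?thesis
    using axis by (simp add: defect_comp_def defect_op_eq)
qed

lemma defect_comp_in:
  assumes "l \<in> L"
  shows "defect_comp L T j l \<in> defect_space L T"
proof -
  have "axis j l \<in> dsum L"
    using assms csubspace_zero[OF subspace] by (auto simp: dsum_def axis_def)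
  then show ?thesis
    unfolding defect_space_def defect_comp_def using closure_subset by fast
qed

lemma defect_comp_nth:
  "l \<in> L \<Longrightarrow> defect_comp L T j l $ i = (if i = j then l else 0) - T_adj i (T j l)"
  by (simp add: defect_comp_eq axis_def)

lemma cinner_defect_comp:
  assumes l: "l \<in> L" and d: "d \<in> defect_space L T"
  shows "cinner (defect_comp L T j l) d = cinner l (d $ j)"
proof -
  have "cinner (row_adj (T j l)) d = 0"
    using d by (simp add: defect_space_eq cinner_row_adj_left)
  moreover have "cinner (axis j l) d = (\<Sum>i\<in>UNIV. if i = j then cinner l (d $ j) else 0)"
    unfolding cinner_vec_def by (rule sum.cong) (auto simp: axis_def)
  ultimately show ?thesis
    using l by (simp add: defect_comp_eq cinner_diff_left)
qed

text \<open>A projection is self-adjoint, so \<open>\<langle>D\<^sub>T (0, \<dots>, l, \<dots>, 0), d\<rangle> = \<langle>l, d\<^sub>j\<rangle>\<close> for \<open>d\<close> in its range.\<close>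

lemma adj_defect_comp:
  "d \<in> defect_space L T \<Longrightarrow> adj_on L (defect_comp L T j) d = d $ j"
  by (intro adj_on_eqI subspace) (simp_all add: defect_nth_in cinner_defect_comp)

text \<open>The map \<open>l \<oplus> d \<mapsto> (T\<^sub>j\<^sup>* l + (D\<^sub>T)\<^sub>j\<^sup>* d)\<^sub>j\<close> preserves inner products, because \<open>T\<^sup>*\<close> is isometric
  and its range is orthogonal to the defect space.\<close>

lemma sum_cinner_step:
  assumes l: "l \<in> L" "m \<in> L" and d: "d \<in> defect_space L T" "e \<in> defect_space L T"
  shows "(\<Sum>j\<in>UNIV. cinner (T_adj j l + d $ j) (T_adj j m + e $ j)) = cinner l m + cinner d e"
proof -
  have "(\<Sum>j\<in>UNIV. cinner (T_adj j l) (T_adj j m)) = (\<Sum>j\<in>UNIV. cinner l (T j (T_adj j m)))"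
    by (simp add: cinner_T_right T_adj_in)
  also have "\<dots> = cinner l m"
    using l by (simp add: sum_T_T_adj flip: cinner_sum_right)
  finally have "(\<Sum>j\<in>UNIV. cinner (T_adj j l) (T_adj j m)) = cinner l m" .
  moreover have "(\<Sum>j\<in>UNIV. cinner (T_adj j l) (e $ j)) = (\<Sum>j\<in>UNIV. cinner l (T j (e $ j)))"
    using d by (simp add: cinner_T_right defect_nth_in)
  then have "(\<Sum>j\<in>UNIV. cinner (T_adj j l) (e $ j)) = 0"
    using d by (simp add: sum_T_defect flip: cinner_sum_right)
  moreover have "(\<Sum>j\<in>UNIV. cinner (d $ j) (T_adj j m)) = (\<Sum>j\<in>UNIV. cinner (T j (d $ j)) m)"
    using d by (simp add: cinner_T_left defect_nth_in)
  then have "(\<Sum>j\<in>UNIV. cinner (d $ j) (T_adj j m)) = 0"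
    using d by (simp add: sum_T_defect flip: cinner_sum_left)
  ultimately show ?thesis
    by (simp add: cinner_add_left cinner_add_right sum.distrib cinner_vec_def)
qed

lemma sum_norm_step:
  assumes "l \<in> L" "d \<in> defect_space L T"
  shows "(\<Sum>j\<in>UNIV. (norm (T_adj j l + d $ j))\<^sup>2) = (norm l)\<^sup>2 + (norm d)\<^sup>2"
proof -
  have "complex_of_real (\<Sum>j\<in>UNIV. (norm (T_adj j l + d $ j))\<^sup>2) = complex_of_real ((norm l)\<^sup>2 + (norm d)\<^sup>2)"
    using sum_cinner_step[OF assms(1,1) assms(2,2)] by (simp add: cinner_self)
  then show ?thesis
    by (simp only: of_real_eq_iff)
qed

end



section \<open>Square-summable families on sets of words\<close>

lemma closed_csubspace_zero [simp]: "closed_csubspace {0}"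
  by (simp add: closed_csubspace_def)

lemma closed_csubspace_Times:
  assumes "closed_csubspace A" "closed_csubspace B"
  shows "closed_csubspace (A \<times> B)"
  using assms by (auto simp: closed_csubspace_def closed_Times scaleC_prod_def zero_prod_def)

lemma bounded_linear_l2_coord: "bounded_linear (\<lambda>y :: ('i, 'a :: real_normed_vector) l2. l2_coord y i)"
  by (rule bounded_linear_intro[where K = 1]) (simp_all add: l2_coord_norm_le)

lemma closed_csubspace_l2:
  fixes B :: "'i \<Rightarrow> 'a::complex_inner set"
  assumes B: "\<And>i. closed_csubspace (B i)"
  shows "closed_csubspace {y. \<forall>i. l2_coord y i \<in> B i}"
proof -
  have "closed ((\<lambda>y. l2_coord y i) -` B i)" for i
    using B[of i] by (intro closed_vimage linear_continuous_on bounded_linear_l2_coord)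
      (simp_all add: closed_csubspace_def)
  moreover have "{y. \<forall>i. l2_coord y i \<in> B i} = (\<Inter>i. (\<lambda>y. l2_coord y i) -` B i)"
    by auto
  ultimately have "closed {y. \<forall>i. l2_coord y i \<in> B i}"
    by (metis (no_types, lifting) closed_INT)
  then show ?thesis
    using B by (auto simp: closed_csubspace_def)
qed

text \<open>The truncation to \<open>A\<close> is meaningful as soon as \<open>f\<close> is square-summable on \<open>A\<close>. It is stated for
  functions, and not only for elements of \<open>l2\<close>, because the finite truncations of the image under
  \<open>hat_W\<close> are used before its square-summability is known.\<close>

definition l2_on :: "'i set \<Rightarrow> ('i \<Rightarrow> 'a) \<Rightarrow> ('i, 'a::real_normed_vector) l2"
  where "l2_on A f = Abs_l2 (\<lambda>i. if i \<in> A then f i else 0)"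

lemma l2_coord_l2_on_summable:
  assumes "(\<lambda>i. (norm (f i))\<^sup>2) summable_on A"
  shows "l2_coord (l2_on A f) i = (if i \<in> A then f i else 0)"
proof -
  have "(\<lambda>i. (norm (if i \<in> A then f i else 0))\<^sup>2) summable_on UNIV"
    using assms by (rule summable_on_cong_neutral[THEN iffD1, rotated -1]) auto
  then show ?thesis
    by (simp add: l2_on_def l2_coord_Abs_l2)
qed

lemma l2_coord_l2_on_finite [simp]:
  "finite A \<Longrightarrow> l2_coord (l2_on A f) i = (if i \<in> A then f i else 0)"
  by (simp add: l2_coord_l2_on_summable)

lemma l2_coord_l2_on [simp]:
  "l2_coord (l2_on A (l2_coord y)) i = (if i \<in> A then l2_coord y i else 0)"
  by (intro l2_coord_l2_on_summable summable_on_subset_banach[OF l2_summable]) simp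

lemma cinner_l2_finite:
  assumes "finite A" "\<And>i. i \<notin> A \<Longrightarrow> cinner (l2_coord x i) (l2_coord y i) = 0"
  shows "cinner x y = (\<Sum>i\<in>A. cinner (l2_coord x i) (l2_coord y i))"
proof -
  have "cinner x y = (\<Sum>\<^sub>\<infinity>i\<in>A. cinner (l2_coord x i) (l2_coord y i))"
    unfolding cinner_l2_def by (rule infsum_cong_neutral) (use assms(2) in auto)
  then show ?thesis using assms(1) by simp
qed

lemma cinner_ket: "cinner y (ket \<alpha> d) = cinner (l2_coord y \<alpha>) d"
  by (subst cinner_l2_finite[of "{\<alpha>}"]) (auto simp: l2_coord_ket)

lemma cinner_ket_left: "cinner (ket \<alpha> d) y = cinner d (l2_coord y \<alpha>)"
  by (subst cinner_l2_finite[of "{\<alpha>}"]) (auto simp: l2_coord_ket)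

text \<open>The truncation error has the norm square \<open>\<Sum>i\<notin>A n. \<parallel>y i\<parallel>\<^sup>2\<close>, a remainder of a convergent sum.\<close>

lemma l2_on_tendsto:
  fixes y :: "('i, 'a::real_normed_vector) l2"
  assumes A: "filterlim A (finite_subsets_at_top UNIV) sequentially"
    and fin: "\<And>n. finite (A n)"
  shows "(\<lambda>n. l2_on (A n) (l2_coord y)) \<longlonglongrightarrow> y"
proof -
  let ?f = "\<lambda>i. (norm (l2_coord y i))\<^sup>2"
  have remainder: "(norm (y - l2_on (A n) (l2_coord y)))\<^sup>2 = infsum ?f UNIV - sum ?f (A n)" for n
  proof -
    have "(\<lambda>i. (norm (l2_coord (y - l2_on (A n) (l2_coord y)) i))\<^sup>2) = (\<lambda>i. if i \<in> A n then 0 else ?f i)"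
      by auto
    then have "(norm (y - l2_on (A n) (l2_coord y)))\<^sup>2 = infsum (\<lambda>i. if i \<in> A n then 0 else ?f i) UNIV"
      by (simp add: norm_l2_def infsum_nonneg)
    also have "\<dots> = infsum ?f (UNIV - A n)"
      by (rule infsum_cong_neutral) auto
    also have "\<dots> = infsum ?f UNIV - infsum ?f (A n)"
      by (intro infsum_Diff l2_summable summable_on_finite fin) simp
    finally show ?thesis using fin by simp
  qed
  have "(\<lambda>n. sum ?f (A n)) \<longlonglongrightarrow> infsum ?f UNIV"
    using has_sum_infsum[OF l2_summable[of y]] A unfolding has_sum_def by (rule filterlim_compose)
  then have "(\<lambda>n. infsum ?f UNIV - sum ?f (A n)) \<longlonglongrightarrow> infsum ?f UNIV - infsum ?f UNIV"
    by (intro tendsto_intros)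
  then have "(\<lambda>n. sqrt ((norm (y - l2_on (A n) (l2_coord y)))\<^sup>2)) \<longlonglongrightarrow> sqrt 0"
    unfolding remainder by (intro tendsto_real_sqrt) simp
  then have "(\<lambda>n. norm (y - l2_on (A n) (l2_coord y))) \<longlonglongrightarrow> 0"
    by simp
  then show ?thesis
    by (subst (asm) norm_minus_commute) (simp add: LIM_zero_cancel tendsto_norm_zero_iff)
qed

abbreviation words :: "nat \<Rightarrow> 'd list set" where "words n \<equiv> {\<alpha>. length \<alpha> = n}"

abbreviation words_between :: "nat \<Rightarrow> nat \<Rightarrow> 'd list set"
  where "words_between m n \<equiv> {\<alpha>. m \<le> length \<alpha> \<and> length \<alpha> < n}"

lemma finite_words [simp]: "finite (words n :: 'd::finite list set)"
  using finite_lists_length_eq[of "UNIV :: 'd set" n] by simp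

lemma finite_words_less [simp]: "finite {\<alpha> :: 'd::finite list. length \<alpha> < n}"
proof -
  have "{\<alpha> :: 'd list. length \<alpha> < n} = (\<Union>m<n. words m)" by auto
  then show ?thesis by simp
qed

lemma finite_words_between [simp]: "finite (words_between m n :: 'd::finite list set)"
  by (rule finite_subset[OF _ finite_words_less[of n]]) auto

lemma filterlim_words_less:
  "filterlim (\<lambda>n. {\<alpha> :: 'd::finite list. length \<alpha> < n}) (finite_subsets_at_top UNIV) sequentially"
proof (rule filterlim_finite_subsets_at_top[THEN iffD2], intro allI impI)
  fix X :: "'d list set" assume X: "finite X \<and> X \<subseteq> UNIV"
  define N where "N = Suc (Max (insert 0 (length ` X)))"
  have "length \<alpha> < N" if "\<alpha> \<in> X" for \<alpha>
    using X that by (simp add: N_def less_Suc_eq_le)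
  then have "\<forall>n\<ge>N. X \<subseteq> {\<alpha>. length \<alpha> < n}" by force
  then show "\<forall>\<^sub>F n in sequentially. finite {\<alpha> :: 'd list. length \<alpha> < n} \<and> X \<subseteq> {\<alpha>. length \<alpha> < n} \<and>
      {\<alpha>. length \<alpha> < n} \<subseteq> UNIV"
    unfolding eventually_sequentially by auto
qed

lemma sum_words_Suc:
  fixes f :: "'d::finite list \<Rightarrow> 'a::comm_monoid_add"
  shows "(\<Sum>\<alpha>\<in>words (Suc n). f \<alpha>) = (\<Sum>\<alpha>\<in>words n. \<Sum>j\<in>UNIV. f (\<alpha> @ [j]))"
proof -
  have eq: "words (Suc n) = (\<lambda>(\<alpha> :: 'd list, j). \<alpha> @ [j]) ` (words n \<times> UNIV)"
    by (auto simp: image_iff length_Suc_conv_rev)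
  have "inj_on (\<lambda>(\<alpha> :: 'd list, j). \<alpha> @ [j]) (words n \<times> UNIV)"
    by (auto simp: inj_on_def)
  then show ?thesis
    unfolding eq by (simp add: sum.reindex sum.cartesian_product case_prod_unfold)
qed

lemma summable_on_Cons:
  fixes f :: "'d list \<Rightarrow> 'a::banach"
  shows "f summable_on UNIV \<Longrightarrow> (\<lambda>\<beta>. f (j # \<beta>)) summable_on UNIV"
  using summable_on_subset_banach[of f UNIV "range ((#) j)"]
  by (simp add: summable_on_reindex o_def)

text \<open>The adjoint of the creation operator, which strips the first letter.\<close>

definition annihilation :: "'d \<Rightarrow> ('d list, 'a::real_normed_vector) l2 \<Rightarrow> ('d list, 'a) l2"
  where "annihilation j y = Abs_l2 (\<lambda>\<beta>. l2_coord y (j # \<beta>))"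

lemma l2_coord_annihilation [simp]: "l2_coord (annihilation j y) \<beta> = l2_coord y (j # \<beta>)"
  using summable_on_Cons[OF l2_summable[of y], of j] by (simp add: annihilation_def l2_coord_Abs_l2)

lemma cinner_creation: "cinner x (creation j y) = cinner (annihilation j x) y"
proof -
  have "cinner x (creation j y) = (\<Sum>\<^sub>\<infinity>\<alpha>\<in>range ((#) j). cinner (l2_coord x \<alpha>) (l2_coord (creation j y) \<alpha>))"
    unfolding cinner_l2_def
    by (rule infsum_cong_neutral) (auto simp: l2_coord_creation split: list.splits)
  also have "\<dots> = cinner (annihilation j x) y"
    by (simp add: infsum_reindex o_def cinner_l2_def l2_coord_creation)
  finally show ?thesis .
qed


section \<open>The unitaries in coordinates\<close>

context coisometric_tuple
begin

text \<open>In terms of the minimal isometric dilation \<open>V\<close>, \<open>orbit l y \<alpha>\<close> is the component in \<open>L\<close>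
  of \<open>V\<^sub>\<alpha>\<^sup>* (l \<oplus> y)\<close>: by definition of \<open>V\<close>, the vector \<open>V\<^sub>j\<^sup>* (l \<oplus> y)\<close> has the component
  \<open>T\<^sub>j\<^sup>* l + (D\<^sub>T)\<^sub>j\<^sup>* y\<^sub>\<emptyset>\<close> in \<open>L\<close>, and \<open>V\<^sub>j\<^sup>*\<close> strips the first letter \<open>j\<close> from the other words. Since
  \<open>D\<^sub>T\<close> is the kernel of the row operator, \<open>(D\<^sub>T)\<^sub>j\<^sup>*\<close> is the \<open>j\<close>-th coordinate.\<close>

primrec orbit :: "'h \<Rightarrow> ('d list \<Rightarrow> 'h ^ 'd) \<Rightarrow> 'd list \<Rightarrow> 'h" where
  "orbit l y [] = l"
| "orbit l y (j # \<alpha>) = orbit (T_adj j l + y [] $ j) (\<lambda>\<beta>. y (j # \<beta>)) \<alpha>"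

lemma orbit_snoc: "orbit l y (\<alpha> @ [j]) = T_adj j (orbit l y \<alpha>) + y \<alpha> $ j"
  by (induction \<alpha> arbitrary: l y) simp_all

lemma orbit_in:
  "l \<in> L \<Longrightarrow> (\<And>\<alpha>. y \<alpha> \<in> defect_space L T) \<Longrightarrow> orbit l y \<alpha> \<in> L"
  by (induction \<alpha> arbitrary: l y)
    (simp_all add: csubspace_add[OF subspace] T_adj_in defect_nth_in)

lemma orbit_zero: "orbit 0 (\<lambda>_. 0) \<alpha> = 0"
  by (induction \<alpha>) (simp_all add: T_adj_zero)

lemma orbit_add: "orbit (l + m) (\<lambda>\<alpha>. y \<alpha> + z \<alpha>) \<alpha> = orbit l y \<alpha> + orbit m z \<alpha>"
proof (induction \<alpha> arbitrary: l m y z)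
  case (Cons j \<alpha>)
  have "T_adj j (l + m) + (y [] + z []) $ j = (T_adj j l + y [] $ j) + (T_adj j m + z [] $ j)"
    by (simp add: T_adj_add)
  then show ?case
    using Cons[of "T_adj j l + y [] $ j" "T_adj j m + z [] $ j" "\<lambda>\<beta>. y (j # \<beta>)" "\<lambda>\<beta>. z (j # \<beta>)"]
    by (simp only: orbit.simps)
qed simp

lemma orbit_scaleC: "orbit (c *\<^sub>C l) (\<lambda>\<alpha>. c *\<^sub>C y \<alpha>) \<alpha> = c *\<^sub>C orbit l y \<alpha>"
proof (induction \<alpha> arbitrary: l y)
  case (Cons j \<alpha>)
  have "T_adj j (c *\<^sub>C l) + (c *\<^sub>C y []) $ j = c *\<^sub>C (T_adj j l + y [] $ j)"
    by (simp add: T_adj_scaleC scaleC_add_right scaleC_vec_def)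
  then show ?case
    using Cons[of "T_adj j l + y [] $ j" "\<lambda>\<beta>. y (j # \<beta>)"] by simp
qed simp

text \<open>The recursion by last letters, which is the one that the unitaries \<open>U\<^sub>n\<close> perform. It is a predicate
  so that it can be verified for a family that is not given as an \<open>orbit\<close>, namely for the
  compression to a subspace of an orbit of another tuple.\<close>

definition is_orbit :: "('d list \<Rightarrow> 'h) \<Rightarrow> ('d list \<Rightarrow> 'h ^ 'd) \<Rightarrow> bool"
  where "is_orbit r y \<longleftrightarrow> (\<forall>\<alpha>. r \<alpha> \<in> L) \<and> (\<forall>\<alpha>. y \<alpha> \<in> defect_space L T) \<and>
    (\<forall>\<alpha> j. r (\<alpha> @ [j]) = T_adj j (r \<alpha>) + y \<alpha> $ j)"

lemma is_orbit_orbit: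
  "l \<in> L \<Longrightarrow> (\<And>\<alpha>. y \<alpha> \<in> defect_space L T) \<Longrightarrow> is_orbit (orbit l y) y"
  by (simp add: is_orbit_def orbit_in orbit_snoc)

text \<open>Conservation of the norm: each step of an orbit is isometric, so level \<open>n\<close> carries exactly the
  norm of the initial vector and of the defect vectors that were fed in on the way.\<close>

lemma sum_norm_orbit:
  assumes "is_orbit r y"
  shows "(\<Sum>\<alpha>\<in>words n. (norm (r \<alpha>))\<^sup>2) =
    (norm (r []))\<^sup>2 + (\<Sum>\<alpha>\<in>{\<alpha>. length \<alpha> < n}. (norm (y \<alpha>))\<^sup>2)"
proof (induction n)
  case (Suc n)
  have split: "{\<alpha> :: 'd list. length \<alpha> < Suc n} = {\<alpha>. length \<alpha> < n} \<union> words n" by auto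
  have "(\<Sum>\<alpha>\<in>words (Suc n). (norm (r \<alpha>))\<^sup>2) = (\<Sum>\<alpha>\<in>words n. (norm (r \<alpha>))\<^sup>2 + (norm (y \<alpha>))\<^sup>2)"
    using assms by (simp add: sum_words_Suc is_orbit_def sum_norm_step)
  then show ?case
    unfolding split by (subst sum.union_disjoint) (auto simp: sum.distrib Suc)
qed simp

lemma hat_space_eq: "hat_space L T = L \<times> {y. \<forall>\<alpha>. l2_coord y \<alpha> \<in> defect_space L T}"
  by (auto simp: hat_space_def)

lemma closed_csubspace_hat_space: "closed_csubspace (hat_space L T)"
  unfolding hat_space_eq
  by (intro closed_csubspace_Times subspace closed_csubspace_l2 closed_csubspace_defect_space)

lemma closed_csubspace_stage_space: "closed_csubspace (stage_space L T n)"
proof -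
  have supported: "(\<forall>\<alpha>. f \<alpha> \<in> S) \<and> (\<forall>\<alpha>. \<not> P \<alpha> \<longrightarrow> f \<alpha> = 0) \<longleftrightarrow> (\<forall>\<alpha>. f \<alpha> \<in> (if P \<alpha> then S else {0}))"
    if "closed_csubspace S" for f :: "'d list \<Rightarrow> 'a::complex_inner" and P S
    unfolding all_conj_distrib[symmetric]
    by (rule all_cong1) (auto simp: csubspace_zero[OF that])
  have "stage_space L T n =
      {g. \<forall>\<alpha>. l2_coord g \<alpha> \<in> (if length \<alpha> = n then L else {0})} \<times>
      {y. \<forall>\<alpha>. l2_coord y \<alpha> \<in> (if \<not> length \<alpha> < n then defect_space L T else {0})}"
    unfolding supported[OF subspace, symmetric] supported[OF closed_csubspace_defect_space, symmetric]
    by (auto simp: stage_space_def)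
  then show ?thesis
    using subspace closed_csubspace_defect_space
    by (simp only:) (intro closed_csubspace_Times closed_csubspace_l2; simp)
qed

lemma stage_U_eq:
  assumes "\<And>\<alpha>. l2_coord y \<alpha> \<in> defect_space L T"
  shows "stage_U L T (Suc n) (g, y) =
    (l2_on (words (Suc n)) (\<lambda>\<alpha>. T_adj (last \<alpha>) (l2_coord g (butlast \<alpha>)) + l2_coord y (butlast \<alpha>) $ last \<alpha>),
     l2_on {\<alpha>. Suc n \<le> length \<alpha>} (l2_coord y))"
  by (simp add: stage_U_def l2_on_def adj_defect_comp[OF assms] cong: if_cong)

text \<open>\<open>U\<^sub>n\<close> absorbs the defect vectors on words of length \<open>n - 1\<close> into the next level of the orbit.\<close>

lemma U_prod_eq:
  assumes "(l, y) \<in> hat_space L T"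
  shows "U_prod L T n (l, y) =
    (l2_on (words n) (orbit l (l2_coord y)), l2_on {\<alpha>. n \<le> length \<alpha>} (l2_coord y))"
proof (induction n)
  case 0
  show ?case
    by (simp add: stage_init_def l2_eq_iff l2_coord_ket)
next
  case (Suc n)
  have y: "l2_coord y \<alpha> \<in> defect_space L T" for \<alpha>
    using assms by (simp add: hat_space_def)
  have "l2_coord (l2_on {\<alpha>. n \<le> length \<alpha>} (l2_coord y)) \<alpha> \<in> defect_space L T" for \<alpha>
    using y csubspace_zero[OF closed_csubspace_defect_space] by simp
  note step = stage_U_eq[OF this]
  have "T_adj (last \<alpha>) (orbit l (l2_coord y) (butlast \<alpha>)) + l2_coord y (butlast \<alpha>) $ last \<alpha> =
      orbit l (l2_coord y) \<alpha>" if "length \<alpha> = Suc n" for \<alpha>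
    using that orbit_snoc[of l "l2_coord y" "butlast \<alpha>" "last \<alpha>"] by (cases \<alpha> rule: rev_cases) simp_all
  then show ?case
    by (auto simp: Suc step l2_eq_iff)
qed

text \<open>Since a step of an orbit is isometric, running it backwards is the adjoint: an orbit at
  level \<open>n + 1\<close> is taken to the same orbit at level \<open>n\<close>, and the defect vectors which it used
  between the two levels reappear in the Fock space.\<close>

lemma adj_stage_U:
  assumes r: "is_orbit r w" and n: "n < N"
  shows "adj_on (stage_space L T n) (stage_U L T (Suc n))
      (l2_on (words (Suc n)) r, l2_on (words_between (Suc n) N) w) =
    (l2_on (words n) r, l2_on (words_between n N) w)"
proof (rule adj_on_eqI[OF closed_csubspace_stage_space])
  show "(l2_on (words n) r, l2_on (words_between n N) w) \<in> stage_space L T n"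
    using r csubspace_zero[OF subspace] csubspace_zero[OF closed_csubspace_defect_space]
    by (simp add: stage_space_def is_orbit_def)
next
  fix a assume "a \<in> stage_space L T n"
  then obtain g y where a: "a = (g, y)" and g: "\<And>\<alpha>. l2_coord g \<alpha> \<in> L"
    and y: "\<And>\<alpha>. l2_coord y \<alpha> \<in> defect_space L T"
    by (auto simp: stage_space_def)
  let ?G = "l2_on (words (Suc n))
    (\<lambda>\<alpha>. T_adj (last \<alpha>) (l2_coord g (butlast \<alpha>)) + l2_coord y (butlast \<alpha>) $ last \<alpha>)"
  have "cinner ?G (l2_on (words (Suc n)) r) =
      (\<Sum>\<alpha>\<in>words n. \<Sum>j\<in>UNIV. cinner (T_adj j (l2_coord g \<alpha>) + l2_coord y \<alpha> $ j) (T_adj j (r \<alpha>) + w \<alpha> $ j))"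
    using r by (subst cinner_l2_finite[of "words (Suc n)"]) (simp_all add: sum_words_Suc is_orbit_def)
  also have "\<dots> = (\<Sum>\<alpha>\<in>words n. cinner (l2_coord g \<alpha>) (r \<alpha>) + cinner (l2_coord y \<alpha>) (w \<alpha>))"
    using r g y by (simp add: sum_cinner_step is_orbit_def)
  finally have G: "cinner ?G (l2_on (words (Suc n)) r) =
      (\<Sum>\<alpha>\<in>words n. cinner (l2_coord g \<alpha>) (r \<alpha>)) + (\<Sum>\<alpha>\<in>words n. cinner (l2_coord y \<alpha>) (w \<alpha>))"
    by (simp add: sum.distrib)
  have Y: "cinner (l2_on {\<alpha>. Suc n \<le> length \<alpha>} (l2_coord y)) (l2_on (words_between (Suc n) N) w) =
      (\<Sum>\<alpha>\<in>words_between (Suc n) N. cinner (l2_coord y \<alpha>) (w \<alpha>))"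
    by (subst cinner_l2_finite[of "words_between (Suc n) N"]) auto
  have g': "cinner g (l2_on (words n) r) = (\<Sum>\<alpha>\<in>words n. cinner (l2_coord g \<alpha>) (r \<alpha>))"
    by (subst cinner_l2_finite[of "words n"]) simp_all
  have split: "words_between n N = words n \<union> (words_between (Suc n) N :: 'd list set)"
    using n by auto
  have "cinner y (l2_on (words_between n N) w) = (\<Sum>\<alpha>\<in>words_between n N. cinner (l2_coord y \<alpha>) (w \<alpha>))"
    by (subst cinner_l2_finite[of "words_between n N"]) auto
  also have "\<dots> = (\<Sum>\<alpha>\<in>words n. cinner (l2_coord y \<alpha>) (w \<alpha>)) +
      (\<Sum>\<alpha>\<in>words_between (Suc n) N. cinner (l2_coord y \<alpha>) (w \<alpha>))"
    unfolding split by (rule sum.union_disjoint) auto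
  finally show "cinner (stage_U L T (Suc n) a) (l2_on (words (Suc n)) r, l2_on (words_between (Suc n) N) w) =
      cinner a (l2_on (words n) r, l2_on (words_between n N) w)"
    using G Y g' by (simp add: a stage_U_eq[OF y] cinner_prod_def)
qed

lemma U_adj_prod_eq:
  assumes r: "is_orbit r w"
  shows "n \<le> N \<Longrightarrow> U_adj_prod L T n (l2_on (words n) r, l2_on (words_between n N) w) =
    (r [], l2_on {\<alpha>. length \<alpha> < N} w)"
proof (induction n)
  case 0
  have "adj_on (hat_space L T) stage_init (l2_on (words 0) r, l2_on (words_between 0 N) w) =
      (r [], l2_on {\<alpha>. length \<alpha> < N} w)"
  proof (rule adj_on_eqI[OF closed_csubspace_hat_space])
    show "(r [], l2_on {\<alpha>. length \<alpha> < N} w) \<in> hat_space L T"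
      using r csubspace_zero[OF closed_csubspace_defect_space] by (simp add: hat_space_def is_orbit_def)
    fix a assume "a \<in> hat_space L T"
    obtain l y where a: "a = (l, y)" by (cases a)
    show "cinner (stage_init a) (l2_on (words 0) r, l2_on (words_between 0 N) w) =
        cinner a (r [], l2_on {\<alpha>. length \<alpha> < N} w)"
      by (simp add: a stage_init_def cinner_prod_def cinner_ket_left)
  qed
  then show ?case by simp
next
  case (Suc n)
  then show ?case using adj_stage_U[OF r, of n N] by simp
qed


section \<open>The isometric dilation in coordinates\<close>

definition hat_V_adj :: "'d \<Rightarrow> 'h \<times> ('d list, 'h ^ 'd) l2 \<Rightarrow> 'h \<times> ('d list, 'h ^ 'd) l2"
  where "hat_V_adj j = (\<lambda>(l, y). (T_adj j l + l2_coord y [] $ j, annihilation j y))"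

lemma hat_V_in: "x \<in> hat_space L T \<Longrightarrow> hat_V L T j x \<in> hat_space L T"
  using csubspace_zero[OF closed_csubspace_defect_space]
  by (auto simp: hat_space_def hat_V_def l2_coord_ket l2_coord_creation T_in defect_comp_in
      split: list.splits)

lemma hat_V_adj_in: "x \<in> hat_space L T \<Longrightarrow> hat_V_adj j x \<in> hat_space L T"
  by (auto simp: hat_space_def hat_V_adj_def csubspace_add[OF subspace] T_adj_in defect_nth_in)

lemma cinner_hat_V:
  assumes "x \<in> hat_space L T" "z \<in> hat_space L T"
  shows "cinner x (hat_V L T j z) = cinner (hat_V_adj j x) z"
proof -
  obtain l y m u where x: "x = (l, y)" and z: "z = (m, u)" by (cases x, cases z)
  have y: "l2_coord y [] \<in> defect_space L T" and m: "m \<in> L"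
    using assms by (simp_all add: x z hat_space_def)
  have "cinner (l2_coord y []) (defect_comp L T j m) = cinner (l2_coord y [] $ j) m"
    using cinner_defect_comp[OF m y, of j] by (subst (1 2) cinner_commute) simp
  then show ?thesis
    using m by (simp add: x z hat_V_def hat_V_adj_def cinner_prod_def cinner_add_right cinner_add_left
        cinner_ket cinner_creation cinner_T_right)
qed

text \<open>This is \<open>V\<^sub>i\<^sup>* V\<^sub>j = \<delta>\<^sub>i\<^sub>j\<close>, read off on orbits: the first step of the orbit of \<open>V\<^sub>j (l \<oplus> y)\<close> gives
  \<open>T\<^sub>i\<^sup>* T\<^sub>j l\<close> plus the \<open>i\<close>-th coordinate of \<open>(I - T\<^sup>* T)\<close> applied to \<open>l\<close> in position \<open>j\<close>.\<close>

lemma orbit_hat_V_Cons: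
  assumes "(l, y) \<in> hat_space L T" and "hat_V L T j (l, y) = (m, z)"
  shows "orbit m (l2_coord z) (i # \<alpha>) = (if i = j then orbit l (l2_coord y) \<alpha> else 0)"
proof -
  have l: "l \<in> L" using assms(1) by (simp add: hat_space_def)
  have m: "m = T j l" and z: "z = ket [] (defect_comp L T j l) + creation j y"
    using assms(2) by (simp_all add: hat_V_def)
  have "T_adj i m + l2_coord z [] $ i = (if i = j then l else 0)"
    by (simp add: m z l2_coord_ket l2_coord_creation defect_comp_nth[OF l])
  moreover have "(\<lambda>\<beta>. l2_coord z (i # \<beta>)) = (if i = j then l2_coord y else (\<lambda>_. 0))"
    by (auto simp: z l2_coord_ket l2_coord_creation)
  ultimately show ?thesis
    by (simp add: orbit_zero)
qed

end



section \<open>The coisometry in coordinates\<close>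

locale coisometric_tuple_lifting =
  C: coisometric_tuple HC C + E: coisometric_tuple UNIV E
  for HC :: "'h::chilbert_space set" and C E :: "'d::finite \<Rightarrow> 'h \<Rightarrow> 'h" +
  assumes proj_E: "proj_on HC (E j h) = C j (proj_on HC h)"
begin

text \<open>The orbit of \<open>x\<close> under the lifting, compressed to \<open>H\<^sub>C\<close>.\<close>

definition shadow :: "'h \<times> ('d list, 'h ^ 'd) l2 \<Rightarrow> 'd list \<Rightarrow> 'h"
  where "shadow x \<alpha> = proj_on HC (E.orbit (fst x) (l2_coord (snd x)) \<alpha>)"

definition shadow_defect :: "'h \<times> ('d list, 'h ^ 'd) l2 \<Rightarrow> 'd list \<Rightarrow> 'h ^ 'd"
  where "shadow_defect x \<alpha> = (\<chi> j. shadow x (\<alpha> @ [j]) - C.T_adj j (shadow x \<alpha>))"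

text \<open>The closed form of \<open>hat_W\<close>.\<close>

definition W :: "'h \<times> ('d list, 'h ^ 'd) l2 \<Rightarrow> 'h \<times> ('d list, 'h ^ 'd) l2"
  where "W x = (proj_on HC (fst x), l2_on UNIV (shadow_defect x))"

lemma proj_in: "proj_on HC h \<in> HC"
  by (rule proj_on_in[OF C.subspace])

lemma shadow_Nil: "shadow x [] = proj_on HC (fst x)"
  by (simp add: shadow_def)

lemma is_orbit_E:
  "x \<in> hat_space UNIV E \<Longrightarrow> E.is_orbit (E.orbit (fst x) (l2_coord (snd x))) (l2_coord (snd x))"
  by (intro E.is_orbit_orbit) (auto simp: hat_space_def)

text \<open>Because \<open>P E\<^sub>j = C\<^sub>j P\<close>, the row operator of \<open>C\<close> maps \<open>(P r(\<alpha> j))\<^sub>j\<close> to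
  \<open>P (\<Sum>j. E\<^sub>j r(\<alpha> j)) = P r(\<alpha>)\<close>. So the part of \<open>(P r(\<alpha> j))\<^sub>j\<close> that is not explained by
  \<open>C\<^sub>j\<^sup>* P r(\<alpha>)\<close> lies in the kernel of the row operator, which is the defect space of \<open>C\<close>.\<close>

lemma is_orbit_shadow:
  assumes "x \<in> hat_space UNIV E"
  shows "C.is_orbit (shadow x) (shadow_defect x)"
proof -
  let ?r = "E.orbit (fst x) (l2_coord (snd x))"
  have shadow_in: "shadow x \<alpha> \<in> HC" for \<alpha>
    by (simp add: shadow_def proj_in)
  have "shadow_defect x \<alpha> \<in> defect_space HC C" for \<alpha>
  proof -
    have d: "l2_coord (snd x) \<alpha> \<in> defect_space UNIV E"
      using assms by (auto simp: hat_space_def)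
    have "(\<Sum>j\<in>UNIV. E j (?r (\<alpha> @ [j]))) = ?r \<alpha>"
      by (simp add: E.orbit_snoc E.T_add sum.distrib E.sum_T_T_adj E.sum_T_defect[OF d])
    moreover have "(\<Sum>j\<in>J. C j (proj_on HC (f j))) = proj_on HC (\<Sum>j\<in>J. E j (f j))" for f J
      by (induction J rule: infinite_finite_induct)
        (simp_all add: proj_on_zero[OF C.subspace] proj_on_add[OF C.subspace] proj_E)
    ultimately have "(\<Sum>j\<in>UNIV. C j (shadow x (\<alpha> @ [j]))) = shadow x \<alpha>"
      by (simp add: shadow_def)
    then have "row_op C (shadow_defect x \<alpha>) = 0"
      by (simp add: row_op_def shadow_defect_def C.T_diff shadow_in C.T_adj_in sum_subtractf C.sum_T_T_adj)
    then show ?thesis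
      unfolding C.defect_space_eq
      by (simp add: dsum_def shadow_defect_def csubspace_diff[OF C.subspace] shadow_in C.T_adj_in)
  qed
  then show ?thesis
    by (simp add: C.is_orbit_def shadow_in shadow_defect_def)
qed

text \<open>The left-hand side is the norm of the shadow at level \<open>n\<close>. It is at most that of the orbit of \<open>x\<close>
  at the same level, which is controlled by the part of \<open>x\<close> that has been consumed.\<close>

lemma sum_shadow_defect_le:
  assumes x: "x \<in> hat_space UNIV E"
  shows "(norm (proj_on HC (fst x)))\<^sup>2 + (\<Sum>\<alpha>\<in>{\<alpha>. length \<alpha> < n}. (norm (shadow_defect x \<alpha>))\<^sup>2) \<le> (norm x)\<^sup>2"
proof -
  have "(norm (proj_on HC (fst x)))\<^sup>2 + (\<Sum>\<alpha>\<in>{\<alpha>. length \<alpha> < n}. (norm (shadow_defect x \<alpha>))\<^sup>2) =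
      (\<Sum>\<alpha>\<in>words n. (norm (shadow x \<alpha>))\<^sup>2)"
    using C.sum_norm_orbit[OF is_orbit_shadow[OF x], of n] by (simp add: shadow_Nil)
  also have "\<dots> \<le> (\<Sum>\<alpha>\<in>words n. (norm (E.orbit (fst x) (l2_coord (snd x)) \<alpha>))\<^sup>2)"
    unfolding shadow_def by (intro sum_mono norm_proj_on_le C.subspace)
  also have "\<dots> = (norm (fst x))\<^sup>2 + (\<Sum>\<alpha>\<in>{\<alpha>. length \<alpha> < n}. (norm (l2_coord (snd x) \<alpha>))\<^sup>2)"
    using E.sum_norm_orbit[OF is_orbit_E[OF x], of n] by simp
  also have "\<dots> \<le> (norm (fst x))\<^sup>2 + (\<Sum>\<^sub>\<infinity>\<alpha>. (norm (l2_coord (snd x) \<alpha>))\<^sup>2)"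
    by (intro add_left_mono finite_sum_le_infsum l2_summable) auto
  also have "\<dots> = (norm x)\<^sup>2"
    by (simp add: norm_prod_def norm_l2_def infsum_nonneg)
  finally show ?thesis .
qed

lemma sum_shadow_defect_le_finite:
  assumes x: "x \<in> hat_space UNIV E" and F: "finite F"
  shows "(\<Sum>\<alpha>\<in>F. (norm (shadow_defect x \<alpha>))\<^sup>2) \<le> (norm x)\<^sup>2 - (norm (proj_on HC (fst x)))\<^sup>2"
proof -
  define n where "n = Suc (Max (insert 0 (length ` F)))"
  have "F \<subseteq> {\<alpha>. length \<alpha> < n}"
    using F by (auto simp: n_def less_Suc_eq_le)
  then have "(\<Sum>\<alpha>\<in>F. (norm (shadow_defect x \<alpha>))\<^sup>2) \<le> (\<Sum>\<alpha>\<in>{\<alpha>. length \<alpha> < n}. (norm (shadow_defect x \<alpha>))\<^sup>2)"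
    by (intro sum_mono2) auto
  then show ?thesis
    using sum_shadow_defect_le[OF x, of n] by linarith
qed

lemma shadow_defect_summable:
  assumes "x \<in> hat_space UNIV E"
  shows "(\<lambda>\<alpha>. (norm (shadow_defect x \<alpha>))\<^sup>2) summable_on UNIV"
  using sum_shadow_defect_le_finite[OF assms]
  by (intro nonneg_bdd_above_summable_on bdd_aboveI2) auto

lemma l2_coord_W:
  "x \<in> hat_space UNIV E \<Longrightarrow> l2_coord (snd (W x)) \<alpha> = shadow_defect x \<alpha>"
  by (simp add: W_def l2_coord_l2_on_summable shadow_defect_summable)

lemma fst_W: "fst (W x) = proj_on HC (fst x)"
  by (simp add: W_def)

lemma W_eqI:
  assumes "x \<in> hat_space UNIV E" and "proj_on HC (fst x) = fst z"
    and "\<And>\<alpha>. shadow_defect x \<alpha> = l2_coord (snd z) \<alpha>"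
  shows "W x = z"
  using assms by (intro prod_eqI) (simp_all add: fst_W l2_eq_iff l2_coord_W)

lemma W_in:
  assumes "x \<in> hat_space UNIV E"
  shows "W x \<in> hat_space HC C"
proof -
  have "fst (W x) \<in> HC \<and> (\<forall>\<alpha>. l2_coord (snd (W x)) \<alpha> \<in> defect_space HC C)"
    using is_orbit_shadow[OF assms] by (simp add: fst_W l2_coord_W[OF assms] proj_in C.is_orbit_def)
  then show ?thesis
    by (auto simp: hat_space_def case_prod_unfold)
qed

lemma norm_W_le:
  assumes x: "x \<in> hat_space UNIV E"
  shows "norm (W x) \<le> norm x"
proof (rule power2_le_imp_le)
  have "(\<Sum>\<^sub>\<infinity>\<alpha>. (norm (shadow_defect x \<alpha>))\<^sup>2) \<le> (norm x)\<^sup>2 - (norm (proj_on HC (fst x)))\<^sup>2"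
    by (rule infsum_le_finite_sums[OF shadow_defect_summable[OF x]]) (rule sum_shadow_defect_le_finite[OF x])
  moreover have "(norm (snd (W x)))\<^sup>2 = (\<Sum>\<^sub>\<infinity>\<alpha>. (norm (shadow_defect x \<alpha>))\<^sup>2)"
    by (simp add: norm_l2_def l2_coord_W[OF x] infsum_nonneg)
  moreover have "(norm (W x))\<^sup>2 = (norm (proj_on HC (fst x)))\<^sup>2 + (norm (snd (W x)))\<^sup>2"
    by (simp add: norm_prod_def fst_W)
  ultimately show "(norm (W x))\<^sup>2 \<le> (norm x)\<^sup>2"
    by linarith
qed simp

lemma bounded_clinear_W: "bounded_clinear_on (hat_space UNIV E) (hat_space HC C) W"
  unfolding bounded_clinear_on_def
proof (intro conjI ballI allI exI[of _ 1])
  note subspace = E.closed_csubspace_hat_space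
  fix x z assume x: "x \<in> hat_space UNIV E" and z: "z \<in> hat_space UNIV E"
  have "l2_coord (snd (x + z)) = (\<lambda>\<alpha>. l2_coord (snd x) \<alpha> + l2_coord (snd z) \<alpha>)"
    by (simp add: fun_eq_iff)
  then have "shadow (x + z) \<alpha> = shadow x \<alpha> + shadow z \<alpha>" for \<alpha>
    using E.orbit_add[of "fst x" "fst z" "l2_coord (snd x)" "l2_coord (snd z)" \<alpha>]
    by (simp add: shadow_def proj_on_add[OF C.subspace])
  then show "W (x + z) = W x + W z"
    by (intro W_eqI csubspace_add[OF subspace] x z)
      (simp_all add: fst_W l2_coord_W x z proj_on_add[OF C.subspace] shadow_defect_def vec_eq_iff C.T_adj_add)
next
  note subspace = E.closed_csubspace_hat_space
  fix c x assume x: "x \<in> hat_space UNIV E"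
  have diff: "c *\<^sub>C (a - b) = c *\<^sub>C a - c *\<^sub>C b" for a b :: 'h
    using scaleC_add_right[of c "a - b" b] by (simp add: algebra_simps)
  have "l2_coord (snd (c *\<^sub>C x)) = (\<lambda>\<alpha>. c *\<^sub>C l2_coord (snd x) \<alpha>)"
    by (simp add: fun_eq_iff scaleC_prod_def)
  then have "shadow (c *\<^sub>C x) \<alpha> = c *\<^sub>C shadow x \<alpha>" for \<alpha>
    using E.orbit_scaleC[of c "fst x" "l2_coord (snd x)" \<alpha>]
    by (simp add: shadow_def proj_on_scaleC[OF C.subspace] scaleC_prod_def)
  then show "W (c *\<^sub>C x) = c *\<^sub>C W x"
    by (intro W_eqI csubspace_scaleC[OF subspace] x)
      (simp_all add: scaleC_prod_def fst_W l2_coord_W x proj_on_scaleC[OF C.subspace]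
        shadow_defect_def vec_eq_iff C.T_adj_scaleC scaleC_vec_def diff)
qed (simp_all add: W_in norm_W_le)

lemma proj_chain_space:
  assumes x: "x \<in> hat_space UNIV E"
  shows "proj_on (chain_space HC n) (U_prod UNIV E n x) = (l2_on (words n) (shadow x), 0)"
proof -
  let ?r = "E.orbit (fst x) (l2_coord (snd x))"
  have U: "U_prod UNIV E n x = (l2_on (words n) ?r, l2_on {\<alpha>. n \<le> length \<alpha>} (l2_coord (snd x)))"
    using E.U_prod_eq[of "fst x" "snd x" n] x by simp
  have chain: "chain_space HC n =
      {g. \<forall>\<alpha>. l2_coord g \<alpha> \<in> (if length \<alpha> = n then HC else {0})} \<times> ({0} :: ('d list, 'h ^ 'd) l2 set)"
    using csubspace_zero[OF C.subspace]
    by (auto simp: chain_space_def split: if_splits) metis+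
  have "closed_csubspace (chain_space HC n :: (('d list, 'h) l2 \<times> ('d list, 'h ^ 'd) l2) set)"
    unfolding chain using C.subspace
    by (intro closed_csubspace_Times closed_csubspace_l2) simp_all
  moreover have "(l2_on (words n) (shadow x), 0) \<in> chain_space HC n"
    using csubspace_zero[OF C.subspace] by (simp add: chain_space_def shadow_def proj_in)
  moreover have "U_prod UNIV E n x - (l2_on (words n) (shadow x), 0) \<in> corth (chain_space HC n)"
    unfolding corth_def
  proof (intro CollectI ballI)
    fix s :: "('d list, 'h) l2 \<times> ('d list, 'h ^ 'd) l2" assume "s \<in> chain_space HC n"
    then obtain g where s: "s = (g, 0)" and g: "\<And>\<alpha>. l2_coord g \<alpha> \<in> HC"
      by (auto simp: chain_space_def)
    have "cinner (l2_coord g \<alpha>) (?r \<alpha> - shadow x \<alpha>) = 0" for \<alpha>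
      using diff_proj_on_in[OF C.subspace, of "?r \<alpha>"] g[of \<alpha>] by (simp add: shadow_def corth_def)
    then have "cinner g (l2_on (words n) ?r - l2_on (words n) (shadow x)) = 0"
      by (subst cinner_l2_finite[of "words n"]) simp_all
    then show "cinner s (U_prod UNIV E n x - (l2_on (words n) (shadow x), 0)) = 0"
      by (simp add: U s cinner_prod_def)
  qed
  ultimately show ?thesis
    by (rule proj_on_eqI)
qed

text \<open>The approximants of \<open>hat_W\<close> are truncations of the vector \<open>W x\<close>: projecting the orbit of
  \<open>x\<close> at level \<open>n\<close> gives its shadow, and running the shadow back to level \<open>0\<close> deposits the defect
  vectors of the shadow on all words shorter than \<open>n\<close>.\<close>

lemma hat_W_eq:
  assumes x: "x \<in> hat_space UNIV E"
  shows "hat_W HC C E x = W x"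
proof -
  have "U_adj_prod HC C n (proj_on (chain_space HC n) (U_prod UNIV E n x)) =
      (fst (W x), l2_on {\<alpha>. length \<alpha> < n} (l2_coord (snd (W x))))" for n
  proof -
    have "l2_on (words_between n n) (shadow_defect x) = 0"
      by (auto simp: l2_eq_iff)
    moreover have "l2_coord (snd (W x)) = shadow_defect x"
      by (simp add: fun_eq_iff l2_coord_W[OF x])
    ultimately show ?thesis
      using C.U_adj_prod_eq[OF is_orbit_shadow[OF x], of n n]
      by (simp add: proj_chain_space[OF x] shadow_Nil fst_W)
  qed
  moreover have "(\<lambda>n. (fst (W x), l2_on {\<alpha>. length \<alpha> < n} (l2_coord (snd (W x)))))
      \<longlonglongrightarrow> (fst (W x), snd (W x))"
    by (intro tendsto_Pair tendsto_const l2_on_tendsto filterlim_words_less) simp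
  ultimately show ?thesis
    unfolding hat_W_def by (simp add: limI)
qed


section \<open>Intertwining\<close>

text \<open>On words that start with a letter, \<open>V\<^sub>j\<close> shifts both orbit and shadow. At the empty word the
  defect vector of the shadow of \<open>V\<^sub>j x\<close> is \<open>(\<delta>\<^sub>i\<^sub>j h - C\<^sub>i\<^sup>* C\<^sub>j h)\<^sub>i\<close> with \<open>h = P l\<close>, which is \<open>(D\<^sub>C)\<^sub>j h\<close>.\<close>

lemma W_hat_V:
  assumes x: "x \<in> hat_space UNIV E"
  shows "W (hat_V UNIV E j x) = hat_V HC C j (W x)"
proof (rule W_eqI[OF E.hat_V_in[OF x]])
  have fst_V: "fst (hat_V UNIV E j x) = E j (fst x)"
    by (simp add: hat_V_def case_prod_unfold)
  then show "proj_on HC (fst (hat_V UNIV E j x)) = fst (hat_V HC C j (W x))"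
    by (simp add: proj_E hat_V_def W_def)
  have cons: "shadow (hat_V UNIV E j x) (i # \<alpha>) = (if i = j then shadow x \<alpha> else 0)" for i \<alpha>
    using E.orbit_hat_V_Cons[of "fst x" "snd x" j "fst (hat_V UNIV E j x)" "snd (hat_V UNIV E j x)" i \<alpha>] x
    by (simp add: shadow_def proj_on_zero[OF C.subspace])
  have nil: "shadow (hat_V UNIV E j x) [] = C j (proj_on HC (fst x))"
    by (simp add: shadow_Nil fst_V proj_E)
  have snd_V: "l2_coord (snd (hat_V HC C j (W x))) \<alpha> =
      (case \<alpha> of [] \<Rightarrow> defect_comp HC C j (proj_on HC (fst x))
        | i # \<beta> \<Rightarrow> if i = j then shadow_defect x \<beta> else 0)" for \<alpha>
    by (simp add: hat_V_def case_prod_unfold l2_coord_ket l2_coord_creation l2_coord_W[OF x] fst_W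
        split: list.split)
  show "shadow_defect (hat_V UNIV E j x) \<alpha> = l2_coord (snd (hat_V HC C j (W x))) \<alpha>" for \<alpha>
  proof (cases \<alpha>)
    case Nil
    then show ?thesis
      by (simp add: snd_V shadow_defect_def vec_eq_iff cons nil C.defect_comp_nth[OF proj_in] shadow_Nil fst_V proj_E)
  next
    case (Cons i \<beta>)
    then show ?thesis
      by (simp add: snd_V shadow_defect_def vec_eq_iff cons C.T_adj_zero)
  qed
qed

text \<open>By definition of orbits, \<open>V\<^sub>j\<^sup>*\<close> shifts the orbit by a first letter \<open>j\<close>; hence it does the same to
  the shadow and to its defect vectors.\<close>

lemma W_hat_V_adj:
  assumes x: "x \<in> hat_space UNIV E"
  shows "W (E.hat_V_adj j x) = C.hat_V_adj j (W x)"
proof (rule W_eqI[OF E.hat_V_adj_in[OF x]])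
  have "l2_coord (annihilation j (snd x)) = (\<lambda>\<beta>. l2_coord (snd x) (j # \<beta>))"
    by (simp add: fun_eq_iff)
  then have cons: "shadow (E.hat_V_adj j x) \<alpha> = shadow x (j # \<alpha>)" for \<alpha>
    by (simp add: shadow_def E.hat_V_adj_def case_prod_unfold)
  show "proj_on HC (fst (E.hat_V_adj j x)) = fst (C.hat_V_adj j (W x))"
    using cons[of "[]"]
    by (simp add: shadow_Nil C.hat_V_adj_def case_prod_unfold fst_W l2_coord_W[OF x] shadow_defect_def)
  show "shadow_defect (E.hat_V_adj j x) \<alpha> = l2_coord (snd (C.hat_V_adj j (W x))) \<alpha>" for \<alpha>
    by (simp add: C.hat_V_adj_def case_prod_unfold l2_coord_W[OF x] shadow_defect_def cons)
qed

text \<open>The adjoint of \<open>W V\<^sub>j\<^sup>* = V\<^sub>j\<^sup>* W\<close>. The bound on \<open>W\<close> enters through the existence of its adjoint.\<close>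

lemma hat_V_hat_W_adj:
  assumes y: "y \<in> hat_space HC C"
  shows "hat_V UNIV E j (hat_W_adj HC C E y) = hat_W_adj HC C E (hat_V HC C j y)"
proof -
  note subspace = E.closed_csubspace_hat_space
  have "bounded_clinear_on (hat_space UNIV E) (hat_space HC C) (hat_W HC C E)"
    using bounded_clinear_W subspace
    by (simp add: bounded_clinear_on_def hat_W_eq csubspace_add csubspace_scaleC)
  note adj = adj_on_in[OF subspace this, of y] cinner_adj_on[OF subspace this, of _ y]
  have "adj_on (hat_space UNIV E) (hat_W HC C E) (hat_V HC C j y) =
      hat_V UNIV E j (adj_on (hat_space UNIV E) (hat_W HC C E) y)"
  proof (rule adj_on_eqI[OF subspace E.hat_V_in[OF adj(1)]])
    fix a assume a: "a \<in> hat_space UNIV E"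
    note a' = E.hat_V_adj_in[OF a, of j]
    have "cinner (hat_W HC C E a) (hat_V HC C j y) = cinner (C.hat_V_adj j (W a)) y"
      using a y by (simp add: hat_W_eq C.cinner_hat_V W_in)
    also have "\<dots> = cinner (hat_W HC C E (E.hat_V_adj j a)) y"
      using a a' by (simp add: hat_W_eq W_hat_V_adj)
    also have "\<dots> = cinner (E.hat_V_adj j a) (adj_on (hat_space UNIV E) (hat_W HC C E) y)"
      by (rule adj(2)[OF a'])
    also have "\<dots> = cinner a (hat_V UNIV E j (adj_on (hat_space UNIV E) (hat_W HC C E) y))"
      using a adj(1) by (simp add: E.cinner_hat_V)
    finally show "cinner (hat_W HC C E a) (hat_V HC C j y) =
        cinner a (hat_V UNIV E j (adj_on (hat_space UNIV E) (hat_W HC C E) y))" .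
  qed
  then show ?thesis
    by (simp add: hat_W_adj_def)
qed

end

text \<open>The block form of a lifting says that \<open>H\<^sub>C\<^sup>\<bottom>\<close> is invariant and that the compression to
  \<open>H\<^sub>C\<close> is \<open>C\<close>; in a single equation, \<open>P E\<^sub>j = C\<^sub>j P\<close>.\<close>

lemma proj_on_coisometric_lifting:
  assumes HC: "closed_csubspace HC" and C: "coisometric HC C" and E: "coisometric_lifting HC C E"
  shows "proj_on HC (E j x) = C j (proj_on HC x)"
proof -
  obtain A B where AB: "\<forall>h\<in>HC. B h \<in> corth HC" "\<forall>k\<in>corth HC. A k \<in> corth HC"
    "\<forall>h\<in>HC. \<forall>k\<in>corth HC. E j (h + k) = C j h + (B h + A k)"
    using E unfolding coisometric_lifting_def by blast
  let ?h = "proj_on HC x" and ?k = "x - proj_on HC x"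
  have h: "?h \<in> HC" and k: "?k \<in> corth HC"
    using proj_on_in[OF HC] diff_proj_on_in[OF HC] by auto
  show ?thesis
  proof (rule proj_on_eqI[OF HC])
    show "C j ?h \<in> HC"
      using C h by (auto simp: coisometric_def bounded_clinear_on_def)
    have "E j x = C j ?h + (B ?h + A ?k)"
      using bspec[OF bspec[OF AB(3) h] k] by simp
    then show "E j x - C j ?h \<in> corth HC"
      using bspec[OF AB(1) h] bspec[OF AB(2) k] by (simp add: csubspace_add[OF closed_csubspace_corth])
  qed
qed

theorem proposition2p2:
  fixes HC :: "'h::chilbert_space set"
    and C E :: "'d::finite \<Rightarrow> 'h \<Rightarrow> 'h"
    and j :: 'd
  assumes "closed_csubspace HC"
    and "coisometric HC C"
    and "coisometric_lifting HC C E"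
  shows "(\<forall>x\<in>hat_space UNIV E.
            hat_W HC C E (hat_V UNIV E j x) = hat_V HC C j (hat_W HC C E x)) \<and>
         (\<forall>y\<in>hat_space HC C.
            hat_V UNIV E j (hat_W_adj HC C E y) = hat_W_adj HC C E (hat_V HC C j y))"
proof -
  interpret coisometric_tuple_lifting HC C E
  proof (intro coisometric_tuple_lifting.intro coisometric_tuple.intro coisometric_tuple_lifting_axioms.intro)
    show "coisometric UNIV E"
      using assms(3) by (simp add: coisometric_lifting_def)
    show "proj_on HC (E i h) = C i (proj_on HC h)" for i h
      by (rule proj_on_coisometric_lifting[OF assms])
  qed (simp_all add: assms)
  show ?thesis
    by (simp add: hat_W_eq E.hat_V_in W_hat_V hat_V_hat_W_adj)
qed

end
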